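(* Let $L$ be a number field, $h(x)$ a monic, irreducible polynomial in $\mathcal{O}_L[x]$, and $\eta$ a root of $h(x)$. Suppose $\mathfrak{p}$ is a prime of $L$ above the rational prime $p$ such that $\mathfrak{p}\mid\Delta_h$. Let $M$ be a finite extension of $L$ such that $h(x)$ is irreducible over $M$. If $\mathfrak{p}$ is ramified in $M$, then $p\mid[\mathcal{O}_{M(\eta)}:\mathcal{O}_M[\eta]]$.
   Context: $\mathcal{O}_F$ denotes the ring of integers of a number field $F$, and $\Delta_h$ denotes the discriminant of the polynomial $h$. The bracket $[\mathcal{O}_{M(\eta)}:\mathcal{O}_M[\eta]]$ denotes the index of $\mathcal{O}_M[\eta]$ in $\mathcal{O}_{M(\eta)}$. *)

theory Defs
  imports
    "HOL-Algebra.Algebra"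
    "HOL-Algebra.Algebraic_Closure_Type"
    "Subresultants.Resultant_Prelim"
begin

text \<open>
  All number fields are subfields (as sets) of one arbitrary ambient field of characteristic 0,
  which also contains the root \<open>\<eta>\<close>, so that \<open>M(\<eta>)\<close> makes sense. The ring operations are those of
  the ambient type; the abbreviation below makes a subset closed under them into a
  HOL-Algebra ring.
\<close>

abbreviation ring_on :: "'a::ring_1 set \<Rightarrow> 'a ring" where
  "ring_on S \<equiv> ring_of_type_algebra\<lparr>carrier := S\<rparr>"

definition number_field :: "'a::field_char_0 set \<Rightarrow> bool" where
  "number_field K \<longleftrightarrow>
     subfield K ring_of_type_algebra \<and> ring.finite_dimension ring_of_type_algebra \<rat> K"

definition finite_field_extension :: "'a::field_char_0 set \<Rightarrow> 'a set \<Rightarrow> bool" where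
  "finite_field_extension K E \<longleftrightarrow>
     subfield K ring_of_type_algebra \<and> subfield E ring_of_type_algebra \<and> K \<subseteq> E \<and>
     ring.finite_dimension ring_of_type_algebra K E"

definition integers_of :: "'a::field_char_0 set \<Rightarrow> 'a set" where
  "integers_of K = {x \<in> K. algebraic_int x}"

definition polys_over :: "'a::zero set \<Rightarrow> 'a poly set" where
  "polys_over S = {f. \<forall>i. Polynomial.coeff f i \<in> S}"

definition irreducible_over :: "'a::comm_ring_1 set \<Rightarrow> 'a poly \<Rightarrow> bool" where
  "irreducible_over S f \<longleftrightarrow> f \<in> polys_over S \<and> ring_irreducible\<^bsub>ring_on (polys_over S)\<^esub> f"

definition poly_disc :: "'a::field_char_0 poly \<Rightarrow> 'a" where
  "poly_disc f =
     (- 1) ^ (Polynomial.degree f * (Polynomial.degree f - 1) div 2) *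
     resultant f (pderiv f) / Polynomial.lead_coeff f"

text \<open>A prime of \<open>K\<close> always means a finite prime.\<close>

definition prime_of :: "'a::field_char_0 set \<Rightarrow> 'a set \<Rightarrow> bool" where
  "prime_of K P \<longleftrightarrow> primeideal P (ring_on (integers_of K)) \<and> P \<noteq> {0}"

definition lies_above :: "'a::field_char_0 set \<Rightarrow> nat \<Rightarrow> bool" where
  "lies_above P p \<longleftrightarrow> P \<inter> \<int> = PIdl\<^bsub>ring_on \<int>\<^esub> (of_nat p)"

definition prime_divides :: "'a::field_char_0 set \<Rightarrow> 'a set \<Rightarrow> 'a \<Rightarrow> bool" where
  "prime_divides K P a \<longleftrightarrow>
     P divides\<^bsub>ideals_set (ring_on (integers_of K))\<^esub> (PIdl\<^bsub>ring_on (integers_of K)\<^esub> a)"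

text \<open>
  The prime factorisation of the extended ideal \<open>P \<O>\<^sub>M\<close> has an exponent (ramification index)
  greater than 1.
\<close>

definition ramified_in :: "'a::field_char_0 set \<Rightarrow> 'a set \<Rightarrow> bool" where
  "ramified_in M P \<longleftrightarrow>
     (\<exists>(S :: 'a set set) (e :: 'a set \<Rightarrow> nat).
        finite S \<and> (\<forall>Q\<in>S. prime_of M Q \<and> e Q \<ge> 1) \<and>
        Idl\<^bsub>ring_on (integers_of M)\<^esub> P =
          (\<Otimes>\<^bsub>ideals_set (ring_on (integers_of M))\<^esub>Q\<in>S.
             Q [^]\<^bsub>ideals_set (ring_on (integers_of M))\<^esub> e Q) \<and>
        (\<exists>Q\<in>S. e Q > 1))"

definition adjoin_field :: "'a::field_char_0 set \<Rightarrow> 'a \<Rightarrow> 'a set" where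
  "adjoin_field K x = generate_field ring_of_type_algebra (insert x K)"

definition adjoin_ring :: "'a::field_char_0 set \<Rightarrow> 'a \<Rightarrow> 'a set" where
  "adjoin_ring A x = generate_ring ring_of_type_algebra (insert x A)"

definition additive_cosets :: "'a::ring_1 set \<Rightarrow> 'a set \<Rightarrow> 'a set set" where
  "additive_cosets A B = rcosets\<^bsub>add_monoid (ring_on A)\<^esub> B"

end

theory Submission
  imports Defs "Jordan_Normal_Form.Char_Poly"
begin

text \<open>
  Write \<open>A\<close> for the ring of integers of \<open>M\<close>. Since \<open>\<pp>\<close> divides the discriminant and the residue
  field of \<open>\<pp>\<close> is perfect, \<open>h = g\<^sup>2 k + r\<close> with \<open>g\<close>, \<open>k\<close> monic over the integers of \<open>L\<close>,
  \<open>deg g > 0\<close>, and all coefficients of \<open>r\<close> in \<open>\<pp>\<close>. Ramification gives a prime \<open>\<qq>\<close> of \<open>M\<close> with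
  \<open>\<pp> \<subseteq> \<qq>\<^sup>2\<close>. Choose \<open>t \<in> M - A\<close> with \<open>t \<qq> \<subseteq> A\<close> and put \<open>x = t g(\<eta>) k(\<eta>)\<close>. Then
  \<open>x\<^sup>2 = - t\<^sup>2 r(\<eta>) k(\<eta>)\<close> lies in \<open>A[\<eta>]\<close>, so \<open>x\<close> is integral, and \<open>p x \<in> A[\<eta>]\<close>; but
  \<open>x \<notin> A[\<eta>]\<close>, since \<open>g k\<close> is monic of degree less than \<open>deg h\<close>. Hence \<open>x\<close> has order \<open>p\<close> in the
  quotient by \<open>A[\<eta>]\<close>, which is finite because the discriminant of \<open>h\<close> annihilates it.

  The factorisation of \<open>h\<close> is found by reducing modulo a prime above \<open>\<pp>\<close> in the ring of all algebraic
  integers: the discriminant is a product of values of \<open>h'\<close> at the roots of \<open>h\<close>, so \<open>h\<close> and \<open>h'\<close>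
  vanish together at a root modulo that prime, and \<open>g\<close> is the minimal polynomial of that root
  over the residue field of \<open>\<pp>\<close>.
\<close>

section \<open>Subrings, ideals and algebraic integers\<close>

text \<open>The argument avoids factoring ideals, localisation and integral bases. One finiteness
  fact replaces them: for a ring of integers \<open>O\<close> and \<open>m > 0\<close> the ring
  \<open>O/mO\<close> is finite. Pigeonhole on powers then yields inverses and \<open>p\<close>-th
  roots in the residue field of \<pp>, and annihilators in \<open>O/pO\<close>.

  The element \<open>t\<close> is \<open>b/p\<close>, where \<open>b\<close> is not divisible by
  \<open>p\<close> in \<open>A\<close> but multiplies \<qq> into \<open>pA\<close>; such a
  \<open>b\<close> exists because \<qq> is a proper ideal containing \<open>p\<close>. So
  \<open>t\<close> clears one factor \<qq>, and since \<open>x\<^sup>2\<close> carries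
  \<open>t\<^sup>2\<close>, it is exactly ramification, that is \<pp> inside the square of \<qq>,
  that makes \<open>t\<^sup>2 r\<close> integral. The multiple \<open>p t\<close> is integral
  because \<open>p\<close> lies in \<qq>.

  The ring of all algebraic integers contains every root of \<open>h\<close> at once, so no
  splitting field has to be handled as a number field. The price is that this ring is not
  noetherian: the prime above \<pp> comes from Zorn's lemma, and a second element of the kind of
  \<open>t\<close>, now for \<pp> in \<open>L\<close>, guarantees that there is a proper ideal to
  start from.\<close>

locale subring_set =
  fixes R :: "'a::idom set"
  assumes one_mem: "1 \<in> R"
    and diff_mem: "x \<in> R \<Longrightarrow> y \<in> R \<Longrightarrow> x - y \<in> R"
    and mult_mem: "x \<in> R \<Longrightarrow> y \<in> R \<Longrightarrow> x * y \<in> R"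
begin

lemma zero_mem: "0 \<in> R"
  using diff_mem[OF one_mem one_mem] by simp

lemma uminus_mem: "x \<in> R \<Longrightarrow> - x \<in> R"
  using diff_mem[OF zero_mem] by force

lemma add_mem: "x \<in> R \<Longrightarrow> y \<in> R \<Longrightarrow> x + y \<in> R"
  using diff_mem[of x "- y"] uminus_mem by force

lemma power_mem: "x \<in> R \<Longrightarrow> x ^ n \<in> R"
  by (induction n) (auto intro: one_mem mult_mem)

lemma sum_mem: "(\<And>i. i \<in> I \<Longrightarrow> f i \<in> R) \<Longrightarrow> sum f I \<in> R"
  by (induction I rule: infinite_finite_induct) (auto intro: zero_mem add_mem)

lemma prod_mem: "(\<And>i. i \<in> I \<Longrightarrow> f i \<in> R) \<Longrightarrow> prod f I \<in> R"
  by (induction I rule: infinite_finite_induct) (auto intro: one_mem mult_mem)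

lemma of_nat_mem: "of_nat n \<in> R"
  by (induction n) (auto intro: zero_mem one_mem add_mem)

lemma of_int_mem: "of_int n \<in> R"
  by (cases n rule: int_cases2) (auto intro: of_nat_mem uminus_mem)

lemma polys_subring: "subring_set (polys_over R)"
proof
  show "1 \<in> polys_over R"
    by (auto simp: polys_over_def coeff_1 intro: zero_mem one_mem)
  fix f g assume "f \<in> polys_over R" "g \<in> polys_over R"
  then show "f - g \<in> polys_over R" "f * g \<in> polys_over R"
    by (auto simp: polys_over_def coeff_mult intro!: diff_mem sum_mem mult_mem)
qed

lemmas polys_zero_mem = subring_set.zero_mem[OF polys_subring]
  and polys_one_mem = subring_set.one_mem[OF polys_subring]
  and polys_add_mem = subring_set.add_mem[OF polys_subring]
  and polys_diff_mem = subring_set.diff_mem[OF polys_subring]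
  and polys_mult_mem = subring_set.mult_mem[OF polys_subring]
  and polys_power_mem = subring_set.power_mem[OF polys_subring]
  and polys_sum_mem = subring_set.sum_mem[OF polys_subring]
  and polys_prod_mem = subring_set.prod_mem[OF polys_subring]

lemma pCons_mem: "a \<in> R \<Longrightarrow> f \<in> polys_over R \<Longrightarrow> pCons a f \<in> polys_over R"
  by (auto simp: polys_over_def coeff_pCons split: nat.splits)

lemma monom_mem: "a \<in> R \<Longrightarrow> monom a n \<in> polys_over R"
  by (auto simp: polys_over_def zero_mem)

lemma smult_mem: "a \<in> R \<Longrightarrow> f \<in> polys_over R \<Longrightarrow> smult a f \<in> polys_over R"
  by (auto simp: polys_over_def mult_mem)

lemma const_mem: "a \<in> R \<Longrightarrow> [:a:] \<in> polys_over R"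
  by (intro pCons_mem polys_zero_mem)

lemma pderiv_mem: "f \<in> polys_over R \<Longrightarrow> pderiv f \<in> polys_over R"
  by (auto simp: polys_over_def coeff_pderiv simp del: of_nat_Suc intro!: mult_mem of_nat_mem)

lemma poly_mem: "f \<in> polys_over R \<Longrightarrow> x \<in> R \<Longrightarrow> poly f x \<in> R"
  unfolding poly_altdef by (auto simp: polys_over_def intro!: sum_mem mult_mem power_mem)

text \<open>Only the leading coefficient of the divisor is ever divided by, and it is 1, so long
  division stays inside \<open>R\<close>. The alternative \<open>r = 0\<close> covers constant
  divisors, below which there is no degree.\<close>

lemma monic_division:
  assumes g: "g \<in> polys_over R" "lead_coeff g = 1" and f: "f \<in> polys_over R"
  shows "\<exists>q\<in>polys_over R. \<exists>r\<in>polys_over R. f = g * q + r \<and> (r = 0 \<or> degree r < degree g)"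
  using f
proof (induction "degree f" arbitrary: f rule: less_induct)
  case less
  show ?case
  proof (cases "f = 0 \<or> degree f < degree g")
    case True
    then show ?thesis
      using less.prems polys_zero_mem by (intro bexI[of _ 0] bexI[of _ f]) auto
  next
    case False
    define m where "m = monom (lead_coeff f) (degree f - degree g)"
    have m: "m \<in> polys_over R"
      using less.prems by (auto simp: m_def polys_over_def intro: zero_mem)
    define f' where "f' = f - g * m"
    have f': "f' \<in> polys_over R"
      unfolding f'_def using less.prems g(1) m by (intro polys_diff_mem polys_mult_mem)
    have deg_m: "degree m = degree f - degree g" "lead_coeff m = lead_coeff f" "m \<noteq> 0"
      using False by (auto simp: m_def degree_monom_eq)
    have deg: "degree (g * m) = degree f"
    proof -
      have "degree (g * m) = degree g + degree m"
        using g(2) deg_m(3) by (intro degree_mult_eq) auto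
      then show ?thesis using deg_m(1) False by auto
    qed
    have top: "coeff f' (degree f) = 0"
    proof -
      have "coeff (g * m) (degree f) = lead_coeff f"
        using coeff_mult_degree_sum[of g m] g(2) deg_m False by auto
      then show ?thesis by (simp add: f'_def)
    qed
    have le: "degree f' \<le> degree f"
      unfolding f'_def using deg by (intro degree_diff_le) auto
    \<comment> \<open>In degree 0 a vanishing top coefficient cannot lower the degree; it makes
      \<open>f'\<close> zero instead.\<close>
    show ?thesis
    proof (cases "f' = 0 \<or> degree f = 0")
      case True
      have "f' = 0"
        using True top le by (metis le_zero_eq leading_coeff_0_iff)
      then show ?thesis
        using m polys_zero_mem by (intro bexI[of _ m] bexI[of _ 0]) (auto simp: f'_def)
    next
      case F: False
      then have "degree f' < degree f"
        using top le by (metis leading_coeff_0_iff nat_less_le)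
      from less.hyps[OF this f'] obtain q r where qr: "q \<in> polys_over R" "r \<in> polys_over R"
        "f' = g * q + r" "r = 0 \<or> degree r < degree g"
        by blast
      have "f = g * (q + m) + r"
        using qr(3) by (simp add: f'_def algebra_simps)
      then show ?thesis
        using qr m polys_add_mem by blast
    qed
  qed
qed

end

lemma polys_over_mono: "R \<subseteq> S \<Longrightarrow> polys_over R \<subseteq> polys_over S"
  by (auto simp: polys_over_def)

locale ideal_set = subring_set R for R :: "'a::idom set" +
  fixes I :: "'a set"
  assumes I_subset: "I \<subseteq> R"
    and I_zero: "0 \<in> I"
    and I_add: "x \<in> I \<Longrightarrow> y \<in> I \<Longrightarrow> x + y \<in> I"
    and I_absorb: "r \<in> R \<Longrightarrow> x \<in> I \<Longrightarrow> r * x \<in> I"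
begin

lemma I_uminus: "x \<in> I \<Longrightarrow> - x \<in> I"
  using I_absorb[OF uminus_mem[OF one_mem]] by simp

lemma I_diff: "x \<in> I \<Longrightarrow> y \<in> I \<Longrightarrow> x - y \<in> I"
  using I_add[of x "- y"] I_uminus by simp

lemma I_absorb': "r \<in> R \<Longrightarrow> x \<in> I \<Longrightarrow> x * r \<in> I"
  using I_absorb by (simp add: mult.commute)

lemma I_sum: "(\<And>i. i \<in> A \<Longrightarrow> f i \<in> I) \<Longrightarrow> sum f A \<in> I"
  by (induction A rule: infinite_finite_induct) (auto intro: I_zero I_add)

text \<open>Lets facts about \<open>ideal_set\<close> be reused one level up, for polynomials modulo
  \<open>I\<close>; in particular the Frobenius congruence
  \<open>freshman_dream_sum\<close>.\<close>

lemma polys_ideal: "ideal_set (polys_over R) (polys_over I)"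
proof (intro ideal_set.intro polys_subring ideal_set_axioms.intro)
  fix f g assume "f \<in> polys_over R" "g \<in> polys_over I"
  then show "f * g \<in> polys_over I"
    by (auto simp: polys_over_def coeff_mult intro!: I_sum I_absorb)
qed (use I_subset in \<open>auto simp: polys_over_def intro: I_zero I_add\<close>)

lemmas polys_I_add = ideal_set.I_add[OF polys_ideal]
  and polys_I_diff = ideal_set.I_diff[OF polys_ideal]
  and polys_I_absorb = ideal_set.I_absorb[OF polys_ideal]

lemma power_diff_mem: 
  assumes "x \<in> R" "y \<in> R" "x - y \<in> I"
  shows "x ^ n - y ^ n \<in> I"
proof (induction n)
  case (Suc n)
  have "x ^ Suc n - y ^ Suc n = x * (x ^ n - y ^ n) + y ^ n * (x - y)"
    by (simp add: algebra_simps)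
  then show ?case
    using Suc assms by (auto intro!: I_add I_absorb power_mem)
qed (simp add: I_zero)

end

section \<open>Integrality through finitely generated additive groups\<close>

definition zspan :: "'a::comm_ring_1 set \<Rightarrow> 'a set" where
  "zspan G = {\<Sum>g\<in>G. of_int (c g) * g | c :: 'a \<Rightarrow> int. True}"

lemma zspan_base:
  assumes "finite G" "g \<in> G"
  shows "g \<in> zspan G"
proof -
  have "(\<Sum>x\<in>G. of_int (if x = g then 1 else 0) * x) = (\<Sum>x\<in>G. if x = g then g else 0)"
    by (intro sum.cong) auto
  also have "\<dots> = g" using assms by simp
  finally show ?thesis
    unfolding zspan_def by (intro CollectI exI[of _ "\<lambda>x. if x = g then 1 else 0"]) auto
qed

lemma zspan_zero: "0 \<in> zspan G"
  unfolding zspan_def by (intro CollectI exI[of _ "\<lambda>_. 0"]) auto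

lemma zspan_add: "x \<in> zspan G \<Longrightarrow> y \<in> zspan G \<Longrightarrow> x + y \<in> zspan G"
proof -
  assume "x \<in> zspan G" "y \<in> zspan G"
  then obtain c d where "x = (\<Sum>g\<in>G. of_int (c g) * g)" "y = (\<Sum>g\<in>G. of_int (d g) * g)"
    by (auto simp: zspan_def)
  then have "x + y = (\<Sum>g\<in>G. of_int (c g + d g) * g)"
    by (simp add: sum.distrib algebra_simps)
  then show ?thesis unfolding zspan_def by (intro CollectI exI[of _ "\<lambda>g. c g + d g"]) auto
qed

lemma zspan_of_int_mult: "x \<in> zspan G \<Longrightarrow> of_int n * x \<in> zspan G"
proof -
  assume "x \<in> zspan G"
  then obtain c where "x = (\<Sum>g\<in>G. of_int (c g) * g)"
    by (auto simp: zspan_def)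
  then have "of_int n * x = (\<Sum>g\<in>G. of_int (n * c g) * g)"
    by (simp add: sum_distrib_left algebra_simps)
  then show ?thesis unfolding zspan_def by (intro CollectI exI[of _ "\<lambda>g. n * c g"]) auto
qed

lemma zspan_sum: "(\<And>i. i \<in> A \<Longrightarrow> f i \<in> zspan G) \<Longrightarrow> sum f A \<in> zspan G"
  by (induction A rule: infinite_finite_induct) (auto intro: zspan_zero zspan_add)

lemma zspan_mult_closed:
  assumes "\<And>g. g \<in> G \<Longrightarrow> a * g \<in> zspan H" "x \<in> zspan G"
  shows "a * x \<in> zspan H"
proof -
  from assms(2) obtain c where "x = (\<Sum>g\<in>G. of_int (c g) * g)"
    by (auto simp: zspan_def)
  then have "a * x = (\<Sum>g\<in>G. of_int (c g) * (a * g))"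
    by (simp add: sum_distrib_left algebra_simps)
  then show ?thesis using assms(1) by (auto intro!: zspan_sum zspan_of_int_mult)
qed

text \<open>The determinant trick: multiplication by \<open>x\<close> on the generators is given by
  an integer matrix with eigenvalue \<open>x\<close>, so \<open>x\<close> is a root of its monic
  characteristic polynomial. The eigenvector lists the generators and is nonzero because 1 is one of
  them.\<close>

lemma algebraic_int_if_stable_zspan:
  fixes x :: "'a::field_char_0"
  assumes G: "finite G" "1 \<in> G" and st: "\<And>g. g \<in> G \<Longrightarrow> x * g \<in> zspan G"
  shows "algebraic_int x"
proof -
  obtain n :: nat and v where v: "bij_betw v {..<n} G"
    using ex_bij_betw_nat_finite[OF G(1)] by (auto simp: lessThan_atLeast0)
  have "\<forall>g\<in>G. \<exists>c :: 'a \<Rightarrow> int. x * g = (\<Sum>y\<in>G. of_int (c y) * y)"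
    using st unfolding zspan_def by blast
  then obtain c :: "'a \<Rightarrow> 'a \<Rightarrow> int" where c: "x * g = (\<Sum>y\<in>G. of_int (c g y) * y)" if "g \<in> G" for g
    by metis
  define A where "A = mat n n (\<lambda>(i,j). c (v i) (v j))"
  define B :: "'a mat" where "B = map_mat of_int A"
  have A: "A \<in> carrier_mat n n" by (simp add: A_def)
  then have B: "B \<in> carrier_mat n n" by (simp add: B_def)
  have vG: "v i \<in> G" if "i < n" for i
    using v that by (auto simp: bij_betw_def)
  have eig: "B *\<^sub>v vec n v = x \<cdot>\<^sub>v vec n v"
  proof (rule eq_vecI)
    fix i assume "i < dim_vec (x \<cdot>\<^sub>v vec n v)"
    then have i: "i < n" by simp
    have "(B *\<^sub>v vec n v) $ i = (\<Sum>j<n. of_int (c (v i) (v j)) * v j)"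
      using i A by (simp add: B_def A_def scalar_prod_def lessThan_atLeast0)
    also have "\<dots> = (\<Sum>y\<in>G. of_int (c (v i) y) * y)"
      using v by (intro sum.reindex_bij_betw) 
    also have "\<dots> = x * v i"
      using c[OF vG[OF i]] by simp
    finally show "(B *\<^sub>v vec n v) $ i = (x \<cdot>\<^sub>v vec n v) $ i"
      using i by simp
  qed (use B in auto)
  obtain i where i: "i < n" "v i = 1"
    using v G(2) by (auto simp: bij_betw_def)
  have "vec n v \<noteq> 0\<^sub>v n"
  proof
    assume "vec n v = 0\<^sub>v n"
    then have "vec n v $ i = 0" using i by simp
    then show False using i by simp
  qed
  then have "eigenvalue B x"
    unfolding eigenvalue_def eigenvector_def using eig B by (intro exI[of _ "vec n v"]) auto
  then have "poly (char_poly B) x = 0"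
    using eigenvalue_root_char_poly[OF B] by simp
  moreover have "char_poly B = map_poly of_int (char_poly A)"
    unfolding B_def by (rule of_int_hom.char_poly_hom[OF A])
  moreover have "lead_coeff (char_poly A) = 1"
    using degree_monic_char_poly[OF A] by simp
  ultimately show ?thesis
    unfolding algebraic_int_altdef_ipoly by metis
qed

text \<open>Powers of \<open>y\<close> below \<open>degree f\<close> suffice, since the monic
  equation rewrites the top power with coefficients that preserve the old group. The last conclusion
  keeps all earlier multipliers stable, which allows elements to be adjoined one after
  another.\<close>

lemma stable_zspan_extend:
  fixes y :: "'a::field_char_0"
  assumes G: "finite G" "1 \<in> G"
    and f: "lead_coeff f = 1" "poly f y = 0"
    and coeffs: "\<And>i g. g \<in> G \<Longrightarrow> coeff f i * g \<in> zspan G"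
  defines "H \<equiv> (\<lambda>(g, i). g * y ^ i) ` (G \<times> {..<degree f})"
  shows "finite H" "1 \<in> H" "\<And>h. h \<in> H \<Longrightarrow> y * h \<in> zspan H"
    "\<And>a. (\<And>g. g \<in> G \<Longrightarrow> a * g \<in> zspan G) \<Longrightarrow> (\<And>h. h \<in> H \<Longrightarrow> a * h \<in> zspan H)"
proof -
  have d: "degree f > 0"
  proof (rule ccontr)
    assume "\<not> degree f > 0"
    then obtain c where "f = [:c:]" by (metis degree_eq_zeroE neq0_conv)
    then show False using f by auto
  qed
  show fin: "finite H" using G by (simp add: H_def)
  show "1 \<in> H"
    unfolding H_def by (rule image_eqI[of _ _ "(1, 0)"]) (use G d in auto)
  have lift: "y ^ i * x \<in> zspan H" if "x \<in> zspan G" "i < degree f" for x i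
  proof (rule zspan_mult_closed[OF _ that(1)])
    fix g assume "g \<in> G"
    then have "g * y ^ i \<in> H" using that(2) by (auto simp: H_def)
    then show "y ^ i * g \<in> zspan H" using zspan_base[OF fin] by (simp add: mult.commute)
  qed
  show "a * h \<in> zspan H" if a: "\<And>g. g \<in> G \<Longrightarrow> a * g \<in> zspan G" and h: "h \<in> H" for a h
  proof -
    from h obtain g i where "h = g * y ^ i" "g \<in> G" "i < degree f" by (auto simp: H_def)
    then show ?thesis using lift[OF a[of g], of i] by (simp add: ac_simps)
  qed
  show "y * h \<in> zspan H" if h: "h \<in> H" for h
  proof -
    from h obtain g i where h: "h = g * y ^ i" "g \<in> G" "i < degree f" by (auto simp: H_def)
    show ?thesis
    proof (cases "Suc i < degree f")
      case True
      then have "g * y ^ Suc i \<in> H" using h by (auto simp: H_def simp del: power_Suc)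
      then show ?thesis using zspan_base[OF fin] h by (simp add: ac_simps)
    next
      case False
      then have i: "Suc i = degree f" using h by simp
      have "0 = (\<Sum>k\<le>degree f. coeff f k * y ^ k)" using f by (simp add: poly_altdef)
      also have "\<dots> = (\<Sum>k<degree f. coeff f k * y ^ k) + y ^ degree f"
        using f by (simp add: lessThan_Suc_atMost[symmetric])
      finally have "y ^ degree f = - (\<Sum>k<degree f. coeff f k * y ^ k)"
        by (simp add: eq_neg_iff_add_eq_0 add.commute)
      then have "y * h = (\<Sum>k<degree f. of_int (-1) * (y ^ k * (coeff f k * g)))"
        using h i by (simp add: sum_distrib_left sum_negf[symmetric] ac_simps flip: power_Suc)
      also have "\<dots> \<in> zspan H"
        using h coeffs by (intro zspan_sum zspan_of_int_mult lift) auto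
      finally show ?thesis .
    qed
  qed
qed

text \<open>One group serves all of \<open>C\<close>, so sums and products of elements of
  \<open>C\<close> preserve it too; this gives the ring structure on algebraic integers.\<close>

lemma stable_zspan_exists:
  fixes C :: "'a::field_char_0 set"
  assumes "finite C" "\<And>c. c \<in> C \<Longrightarrow> algebraic_int c"
  shows "\<exists>G. finite G \<and> 1 \<in> G \<and> (\<forall>c\<in>C. \<forall>g\<in>G. c * g \<in> zspan G)"
  using assms
proof (induction C rule: finite_induct)
  case empty
  then show ?case by (intro exI[of _ "{1}"]) auto
next
  case (insert y C)
  then obtain G where G: "finite G" "1 \<in> G" "\<And>c g. c \<in> C \<Longrightarrow> g \<in> G \<Longrightarrow> c * g \<in> zspan G"
    by blast
  obtain f where f: "lead_coeff f = 1" "\<forall>i. coeff f i \<in> \<int>" "poly f y = 0"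
    using insert.prems[of y] by (auto elim: algebraic_int.cases)
  have "coeff f i * g \<in> zspan G" if "g \<in> G" for i g
    using f(2) that by (metis G(1) Ints_cases zspan_base zspan_of_int_mult)
  note ext = stable_zspan_extend[OF G(1,2) f(1,3) this]
  define H where "H = (\<lambda>(g, i). g * y ^ i) ` (G \<times> {..<degree f})"
  have "c * h \<in> zspan H" if ch: "c \<in> insert y C" "h \<in> H" for c h
  proof (cases "c = y")
    case True
    then show ?thesis using ext(3)[folded H_def] ch(2) by blast
  next
    case False
    then show ?thesis using ch ext(4)[folded H_def, of c h] G(3) by blast
  qed
  then show ?case using ext(1,2)[folded H_def] by blast
qed

lemma algebraic_int_add_mult:
  fixes a b :: "'a::field_char_0"
  assumes "algebraic_int a" "algebraic_int b"
  shows algebraic_int_add: "algebraic_int (a + b)" and algebraic_int_mult: "algebraic_int (a * b)"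
proof -
  obtain G where G: "finite G" "1 \<in> G" and c: "\<forall>c\<in>{a,b}. \<forall>g\<in>G. c * g \<in> zspan G"
    using stable_zspan_exists[of "{a,b}"] assms by auto
  show "algebraic_int (a + b)"
    using G c by (intro algebraic_int_if_stable_zspan[of G]) (auto simp: distrib_right intro: zspan_add)
  show "algebraic_int (a * b)"
    using G c by (intro algebraic_int_if_stable_zspan[of G])
      (auto simp: mult.assoc intro: zspan_mult_closed)
qed

lemma subring_algebraic_int: "subring_set {x :: 'a::field_char_0. algebraic_int x}"
proof
  fix x y :: 'a assume *: "x \<in> {x. algebraic_int x}" "y \<in> {x. algebraic_int x}"
  have "algebraic_int (x + (- y))"
    by (rule algebraic_int_add) (use * in auto)
  then show "x - y \<in> {x. algebraic_int x}" by simp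
qed (auto intro: algebraic_int_mult int_imp_algebraic_int)

text \<open>Transitivity of integrality: a group stable under the coefficients is enlarged by powers
  of \<open>y\<close> to one stable under \<open>y\<close>.\<close>

lemma algebraic_int_root_of_monic:
  fixes y :: "'a::field_char_0"
  assumes f: "lead_coeff f = 1" "poly f y = 0" and c: "\<And>i. algebraic_int (coeff f i)"
  shows "algebraic_int y"
proof -
  obtain G where G: "finite G" "1 \<in> G" and cG: "\<forall>c\<in>set (coeffs f). \<forall>g\<in>G. c * g \<in> zspan G"
  proof -
    have "algebraic_int a" if "a \<in> set (coeffs f)" for a
      using that c by (auto simp: coeffs_def split: if_splits)
    then show ?thesis using stable_zspan_exists[of "set (coeffs f)"] that by auto
  qed
  have "coeff f i * g \<in> zspan G" if "g \<in> G" for g i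
  proof (cases "i \<le> degree f \<and> f \<noteq> 0")
    case True
    then have "coeff f i \<in> set (coeffs f)" by (simp add: coeff_in_coeffs)
    then show ?thesis using cG that by blast
  qed (auto simp: not_le zspan_zero coeff_eq_0)
  note ext = stable_zspan_extend[OF G f this]
  show ?thesis
    by (rule algebraic_int_if_stable_zspan[OF ext(1-3)])
qed

section \<open>Finiteness of residue rings\<close>

text \<open>The ambient field as a rational vector space, for the sake of the exchange bound on
  independent sets in a finite span.\<close>

interpretation rat_vs: vector_space "\<lambda>(q::rat) (x::'a::field_char_0). of_rat q * x"
  by unfold_locales (auto simp: of_rat_add of_rat_mult algebra_simps)

text \<open>Finiteness of \<open>R/mR\<close>, phrased by a finite set of representatives so that no
  quotient ring has to be formed.\<close>

definition finite_residues :: "'a::comm_ring_1 set \<Rightarrow> nat \<Rightarrow> bool" where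
  "finite_residues R m \<longleftrightarrow>
     (\<exists>F. finite F \<and> F \<subseteq> R \<and> (\<forall>x\<in>R. \<exists>f\<in>F. \<exists>r\<in>R. x = f + of_nat m * r))"

text \<open>Elements that are independent modulo \<open>p\<close> are independent over \<open>\<rat>\<close>, because an integral
  relation between them could be divided by \<open>p\<close> indefinitely.\<close>

lemma independent_mod_prime_card_le:
  fixes R :: "'a::field_char_0 set"
  assumes "finite T" "R \<subseteq> rat_vs.span T" "0 \<in> R" and p: "p > 1"
    and B: "finite B" "B \<subseteq> R"
    and ind: "\<And>(c :: 'a \<Rightarrow> int) r. r \<in> R \<Longrightarrow> (\<Sum>b\<in>B. of_int (c b) * b) = of_nat p * r \<Longrightarrow> \<forall>b\<in>B. int p dvd c b"
  shows "card B \<le> card T"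
proof -
  have "\<not> rat_vs.dependent B"
  proof
    assume "rat_vs.dependent B"
    then obtain u where u: "\<exists>v\<in>B. u v \<noteq> 0" "(\<Sum>v\<in>B. of_rat (u v) * v) = 0"
      using rat_vs.dependent_finite[OF B(1)] by auto
    \<comment> \<open>A common denominator, turning the rational relation into an integral
      one.\<close>
    define d where "d = (\<Prod>v\<in>B. snd (quotient_of (u v)))"
    have d: "d \<noteq> 0"
      unfolding d_def using B(1) quotient_of_denom_pos' by (metis less_numeral_extra(3) prod_zero_iff)
    have "\<exists>c :: int. of_int d * u v = of_int c" if "v \<in> B" for v
    proof -
      obtain a b where ab: "quotient_of (u v) = (a, b)" by fastforce
      then have "u v = of_int a / of_int b" "b > 0"
        using quotient_of_div quotient_of_denom_pos by auto
      moreover have "b dvd d"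
        unfolding d_def using that B(1) ab by (metis dvd_prodI snd_conv)
      ultimately show ?thesis
        by (auto simp: dvd_def intro!: exI[of _ "a * (d div b)"])
    qed
    then obtain c :: "'a \<Rightarrow> int" where c: "\<And>v. v \<in> B \<Longrightarrow> of_int d * u v = of_int (c v)"
      by metis
    have rel: "(\<Sum>v\<in>B. of_int (c v) * v) = 0"
    proof -
      have "of_int (c v) * v = of_int d * (of_rat (u v) * v)" if "v \<in> B" for v
        using c[OF that] by (metis mult.assoc of_rat_mult of_rat_of_int_eq)
      then have "(\<Sum>v\<in>B. of_int (c v) * v) = of_int d * (\<Sum>v\<in>B. of_rat (u v) * v)"
        unfolding sum_distrib_left by (intro sum.cong refl)
      then show ?thesis using u by simp
    qed
    obtain v where v: "v \<in> B" "c v \<noteq> 0"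
      using u(1) c d by (metis mult_eq_0_iff of_int_eq_0_iff)
    \<comment> \<open>Descent: the relation divided by \<open>p ^ k\<close> still sums to zero, so
      \<open>ind\<close> applies to it with \<open>r = 0\<close> and yields one more factor
      \<open>p\<close>.\<close>
    have "\<forall>b\<in>B. int p ^ k dvd c b" for k
    proof (induction k)
      case (Suc k)
      then have "\<forall>b\<in>B. \<exists>e. c b = int p ^ k * e" by (auto simp: dvd_def)
      then obtain e where e: "\<And>b. b \<in> B \<Longrightarrow> c b = int p ^ k * e b" by metis
      have "of_nat p ^ k * (\<Sum>b\<in>B. of_int (e b) * b) = (\<Sum>b\<in>B. of_int (c b) * b)"
        by (auto simp: sum_distrib_left e ac_simps intro!: sum.cong)
      then have "(\<Sum>b\<in>B. of_int (e b) * b) = of_nat p * 0"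
        using rel p by simp
      from ind[OF \<open>0 \<in> R\<close> this] show ?case using e by (auto simp: mult.commute)
    qed simp
    \<comment> \<open>The exponent is chosen because \<open>n < p ^ n\<close>: a nonzero integer is
      not divisible by so high a power.\<close>
    then have "int p ^ nat \<bar>c v\<bar> dvd c v" using v by blast
    then have "int p ^ nat \<bar>c v\<bar> \<le> \<bar>c v\<bar>"
      using v zdvd_imp_le[of _ "\<bar>c v\<bar>"] by simp
    moreover have "nat \<bar>c v\<bar> < p ^ nat \<bar>c v\<bar>"
      using p by (intro power_gt_expt) simp
    then have "\<bar>c v\<bar> < int p ^ nat \<bar>c v\<bar>"
      by (metis abs_ge_zero int_nat_eq of_nat_less_iff of_nat_power)
    ultimately show False by simp
  qed
  then show ?thesis
    using rat_vs.independent_span_bound[OF assms(1), of B] B assms(2) by blast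
qed

text \<open>A set \<open>B\<close> that is independent modulo \<open>p\<close> and of maximal size
  exists by the dimension bound. Maximality makes every element of \<open>R\<close> an integer
  combination of \<open>B\<close> modulo \<open>pR\<close>, and the coefficients can be reduced to
  \<open>0, ..., p - 1\<close>.\<close>

lemma finite_residues_prime:
  fixes R :: "'a::field_char_0 set"
  assumes R: "subring_set R" and T: "finite T" "R \<subseteq> rat_vs.span T" and p: "Factorial_Ring.prime p"
  shows "finite_residues R p"
proof -
  interpret subring_set R by fact
  have p1: "p > 1" using p by (rule prime_gt_1_nat)
  define ind where "ind B \<longleftrightarrow> finite B \<and> B \<subseteq> R \<and>
    (\<forall>(c :: 'a \<Rightarrow> int). \<forall>r\<in>R. (\<Sum>b\<in>B. of_int (c b) * b) = of_nat p * r \<longrightarrow> (\<forall>b\<in>B. int p dvd c b))" for B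
  have "ind {}" by (simp add: ind_def)
  moreover have "\<forall>B. ind B \<longrightarrow> card B < Suc (card T)"
    unfolding less_Suc_eq_le
  proof (intro allI impI)
    fix B assume "ind B"
    then show "card B \<le> card T"
      unfolding ind_def by (intro independent_mod_prime_card_le[OF T zero_mem p1]) blast+
  qed
  ultimately obtain B where B: "ind B" and mx: "\<And>B'. ind B' \<Longrightarrow> card B' \<le> card B"
    using ex_has_greatest_nat[of ind "{}" card "Suc (card T)"] by auto
  have finB: "finite B" and BR: "B \<subseteq> R" using B by (auto simp: ind_def)
  have ex: "\<exists>(e :: 'a \<Rightarrow> int). \<exists>r\<in>R. x = (\<Sum>b\<in>B. of_int (e b) * b) + of_nat p * r" if x: "x \<in> R" for x
  proof (cases "x \<in> B")
    case True
    have "(\<Sum>b\<in>B. of_int (if b = x then 1 else 0) * b) = (\<Sum>b\<in>B. if b = x then x else 0)"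
      by (intro sum.cong) auto
    also have "\<dots> = x" using True finB by simp
    finally show ?thesis
      using zero_mem by (intro exI[of _ "\<lambda>b. if b = x then 1 else 0"] bexI[of _ 0]) auto
  next
    case False
    have "\<not> ind (insert x B)"
      using mx[of "insert x B"] False finB by auto
    then obtain c :: "'a \<Rightarrow> int" and r where r: "r \<in> R"
      and c: "(\<Sum>b\<in>insert x B. of_int (c b) * b) = of_nat p * r"
      and nd: "\<not> (\<forall>b\<in>insert x B. int p dvd c b)"
      using finB BR x unfolding ind_def by auto
    have c': "of_int (c x) * x + (\<Sum>b\<in>B. of_int (c b) * b) = of_nat p * r"
      using c False finB by simp
    have "\<not> int p dvd c x"
    proof
      assume "int p dvd c x"
      then obtain k where k: "c x = int p * k" by (auto simp: dvd_def)
      have "(\<Sum>b\<in>B. of_int (c b) * b) = of_nat p * (r - of_int k * x)"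
        using c' k by (simp add: algebra_simps eq_diff_eq)
      moreover have "r - of_int k * x \<in> R"
        using r x by (intro diff_mem mult_mem of_int_mem)
      ultimately have "\<forall>b\<in>B. int p dvd c b"
        using B unfolding ind_def by blast
      then show False using nd \<open>int p dvd c x\<close> by auto
    qed
    \<comment> \<open>The coefficient of \<open>x\<close> in the new relation is invertible modulo
      \<open>p\<close>, so the relation can be solved for \<open>x\<close>.\<close>
    then have "coprime (int p) (c x)"
      using p by (intro prime_imp_coprime) auto
    then obtain k s where ks: "k * int p + s * c x = 1"
      using bezout_int[of "int p" "c x"] by (metis coprime_iff_gcd_eq_1)
    have "x = of_int (k * int p + s * c x) * x" using ks by simp
    also have "\<dots> = of_int s * (of_int (c x) * x) + of_nat p * (of_int k * x)"
      by (simp add: algebra_simps)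
    also have "of_int (c x) * x = of_nat p * r - (\<Sum>b\<in>B. of_int (c b) * b)"
      using c' by (simp add: algebra_simps)
    also have "of_int s * (of_nat p * r - (\<Sum>b\<in>B. of_int (c b) * b)) + of_nat p * (of_int k * x)
      = (\<Sum>b\<in>B. of_int (- s * c b) * b) + of_nat p * (of_int s * r + of_int k * x)"
      by (simp add: algebra_simps sum_distrib_left sum_negf)
    finally have "x = (\<Sum>b\<in>B. of_int (- s * c b) * b) + of_nat p * (of_int s * r + of_int k * x)" .
    moreover have "of_int s * r + of_int k * x \<in> R"
      using r x by (intro add_mem mult_mem of_int_mem)
    ultimately show ?thesis by (intro exI[of _ "\<lambda>b. - s * c b"]) blast
  qed
  define F where "F = (\<lambda>c. \<Sum>b\<in>B. of_int (c b) * b) ` (B \<rightarrow>\<^sub>E {0..<int p})"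
  show ?thesis
    unfolding finite_residues_def
  proof (intro exI conjI ballI)
    show "finite F" unfolding F_def using finB by (intro finite_imageI finite_PiE) auto
    show "F \<subseteq> R" unfolding F_def using BR by (auto intro!: sum_mem mult_mem of_int_mem)
    fix x assume "x \<in> R"
    then obtain e :: "'a \<Rightarrow> int" and r where r: "r \<in> R"
      and x: "x = (\<Sum>b\<in>B. of_int (e b) * b) + of_nat p * r"
      using ex by blast
    define c where "c = restrict (\<lambda>b. e b mod int p) B"
    have "of_int (e b) * b = of_int (c b) * b + of_nat p * (of_int (e b div int p) * b)" if "b \<in> B" for b
    proof -
      have "(of_int (e b) :: 'a) = of_int (e b mod int p + int p * (e b div int p))" by simp
      also have "\<dots> = of_int (c b) + of_nat p * of_int (e b div int p)"
        using that by (simp only: of_int_add of_int_mult of_int_of_nat_eq c_def restrict_apply if_True)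
      finally show ?thesis by (simp only: distrib_right mult.assoc)
    qed
    then have "x = (\<Sum>b\<in>B. of_int (c b) * b) + of_nat p * ((\<Sum>b\<in>B. of_int (e b div int p) * b) + r)"
      by (simp add: x sum.distrib sum_distrib_left algebra_simps)
    moreover have "(\<Sum>b\<in>B. of_int (c b) * b) \<in> F"
      unfolding F_def using p1 by (intro imageI) (auto simp: c_def)
    moreover have "(\<Sum>b\<in>B. of_int (e b div int p) * b) + r \<in> R"
      using r BR by (intro add_mem sum_mem mult_mem of_int_mem) auto
    ultimately show "\<exists>f\<in>F. \<exists>r\<in>R. x = f + of_nat p * r" by blast
  qed
qed

lemma finite_residues_mult:
  assumes R: "subring_set R" and "finite_residues R m" "finite_residues R n"
  shows "finite_residues R (m * n)"
proof -
  interpret subring_set R by fact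
  from assms obtain F G where F: "finite F" "F \<subseteq> R" "\<forall>x\<in>R. \<exists>f\<in>F. \<exists>r\<in>R. x = f + of_nat m * r"
    and G: "finite G" "G \<subseteq> R" "\<forall>x\<in>R. \<exists>f\<in>G. \<exists>r\<in>R. x = f + of_nat n * r"
    unfolding finite_residues_def by metis
  define H where "H = (\<lambda>(f, g). f + of_nat m * g) ` (F \<times> G)"
  show ?thesis
    unfolding finite_residues_def
  proof (intro exI conjI ballI)
    show "finite H" using F G by (simp add: H_def)
    show "H \<subseteq> R" unfolding H_def using F(2) G(2) by (auto intro!: add_mem mult_mem of_nat_mem)
    fix x assume "x \<in> R"
    then obtain f r where f: "f \<in> F" "r \<in> R" "x = f + of_nat m * r" using F by blast
    obtain g s where g: "g \<in> G" "s \<in> R" "r = g + of_nat n * s" using G f(2) by blast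
    have "x = (f + of_nat m * g) + of_nat (m * n) * s"
      using f g by (simp add: algebra_simps)
    moreover have "f + of_nat m * g \<in> H" using f g by (auto simp: H_def)
    ultimately show "\<exists>f\<in>H. \<exists>r\<in>R. x = f + of_nat (m * n) * r" using g by blast
  qed
qed

lemma finite_residues_all:
  fixes R :: "'a::field_char_0 set"
  assumes R: "subring_set R" and T: "finite T" "R \<subseteq> rat_vs.span T" and "m > 0"
  shows "finite_residues R m"
  using \<open>m > 0\<close>
proof (induction m rule: less_induct)
  case (less m)
  show ?case
  proof (cases "m = 1")
    case True
    then show ?thesis
      using subring_set.zero_mem[OF R] unfolding finite_residues_def
      by (intro exI[of _ "{0}"]) auto
  next
    case False
    then obtain p k where p: "Factorial_Ring.prime p" "m = p * k"
      using prime_factor_nat[of m] by (auto simp: dvd_def)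
    then have "0 < k" "k < m"
      using less.prems prime_gt_1_nat[OF p(1)] by auto
    then show ?thesis
      using finite_residues_mult[OF R finite_residues_prime[OF R T p(1)]] less.IH p(2) by auto
  qed
qed

section \<open>Subfields of the ambient field and their finite spans over the rationals\<close>

lemma subfield_subring_set:
  fixes K :: "'a::field_char_0 set"
  assumes "subfield K ring_of_type_algebra"
  shows "subring_set K"
proof -
  interpret A: field "ring_of_type_algebra :: 'a ring" ..
  note s = subringE[OF subfieldE(1)[OF assms]]
  have um: "\<ominus>\<^bsub>ring_of_type_algebra\<^esub> y = - y" for y :: 'a
    using A.minus_equality[of "- y" y] by (simp add: ring_of_type_algebra_def)
  show ?thesis
  proof
    show "1 \<in> K" using s(3) by (simp add: ring_of_type_algebra_def)
    fix x y assume "x \<in> K" "y \<in> K"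
    then show "x * y \<in> K" "x - y \<in> K"
      using s(6)[of x y] s(7)[of x "- y"] s(5)[of y] um[of y] by (auto simp: ring_of_type_algebra_def)
  qed
qed

lemma ring_of_type_algebra_inverse:
  fixes x :: "'a::field_char_0"
  assumes "x \<noteq> 0"
  shows "inv\<^bsub>ring_of_type_algebra\<^esub> x = inverse x"
proof -
  interpret A: field "ring_of_type_algebra :: 'a ring" ..
  show ?thesis
    using A.comm_inv_char[of x "inverse x"] assms by (simp add: ring_of_type_algebra_def)
qed

lemma subfield_inverse_mem:
  fixes K :: "'a::field_char_0 set"
  assumes "subfield K ring_of_type_algebra" "x \<in> K"
  shows "inverse x \<in> K"
proof (cases "x = 0")
  case True
  then show ?thesis using assms by simp
next
  case False
  interpret A: field "ring_of_type_algebra :: 'a ring" ..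
  show ?thesis
    using A.subfield_m_inv(1)[OF assms(1), of x] assms(2) False ring_of_type_algebra_inverse[OF False]
    by (simp add: ring_of_type_algebra_def)
qed

text \<open>The inductive notion of dimension adds one vector at a time; explicit coordinates are
  what the tower argument for \<open>L\<close> and \<open>M\<close> multiplies together.\<close>

lemma dimension_imp_spanning_family:
  fixes K E :: "'a::field_char_0 set"
  assumes "ring.dimension ring_of_type_algebra n K E"
  shows "\<exists>v :: nat \<Rightarrow> 'a. \<forall>x\<in>E. \<exists>c. (\<forall>i<n. c i \<in> K) \<and> x = (\<Sum>i<n. c i * v i)"
proof -
  interpret A: field "ring_of_type_algebra :: 'a ring" ..
  show ?thesis
    using assms
  proof (induction rule: A.dimension.induct)
    case (zero_dim K)
    then show ?case by (simp add: ring_of_type_algebra_def)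
  next
    case (Suc_dim w E n K)
    then obtain v :: "nat \<Rightarrow> 'a" where v: "\<forall>x\<in>E. \<exists>c. (\<forall>i<n. c i \<in> K) \<and> x = (\<Sum>i<n. c i * v i)"
      by blast
    show ?case
    proof (rule exI[of _ "v(n := w)"], rule ballI)
      fix x assume "x \<in> A.line_extension K w E"
      then obtain k e where k: "k \<in> K" "e \<in> E" "x = k * w + e"
        unfolding A.line_extension_mem_iff by (auto simp: ring_of_type_algebra_def)
      obtain c where c: "\<forall>i<n. c i \<in> K" "e = (\<Sum>i<n. c i * v i)"
        using v k by blast
      show "\<exists>c. (\<forall>i<Suc n. c i \<in> K) \<and> x = (\<Sum>i<Suc n. c i * (v(n := w)) i)"
        using k c by (intro exI[of _ "c(n := k)"]) (auto simp: less_Suc_eq)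
    qed
  qed
qed

text \<open>The spanning half of the tower law: products of a spanning family of \<open>L\<close>
  with one of \<open>M\<close> over \<open>L\<close>.\<close>

lemma finite_rational_span:
  fixes L M :: "'a::field_char_0 set"
  assumes "number_field L" "finite_field_extension L M"
  obtains T where "finite T" "M \<subseteq> rat_vs.span T"
proof -
  interpret A: field "ring_of_type_algebra :: 'a ring" ..
  obtain n where "A.dimension n \<rat> L"
    using assms(1) by (auto simp: number_field_def A.finite_dimension_def)
  from dimension_imp_spanning_family[OF this]
  obtain u :: "nat \<Rightarrow> 'a" where u: "\<And>x. x \<in> L \<Longrightarrow> \<exists>c. (\<forall>i<n. c i \<in> \<rat>) \<and> x = (\<Sum>i<n. c i * u i)"
    by blast
  obtain m where "A.dimension m L M"
    using assms(2) by (auto simp: finite_field_extension_def A.finite_dimension_def)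
  from dimension_imp_spanning_family[OF this]
  obtain v :: "nat \<Rightarrow> 'a" where v: "\<And>x. x \<in> M \<Longrightarrow> \<exists>c. (\<forall>i<m. c i \<in> L) \<and> x = (\<Sum>i<m. c i * v i)"
    by blast
  define T where "T = (\<lambda>(i, j). u i * v j) ` ({..<n} \<times> {..<m})"
  show ?thesis
  proof
    show "finite T" by (simp add: T_def)
    show "M \<subseteq> rat_vs.span T"
    proof
      fix x assume "x \<in> M"
      then obtain c where c: "\<forall>j<m. c j \<in> L" "x = (\<Sum>j<m. c j * v j)" using v by blast
      have "c j * v j \<in> rat_vs.span T" if j: "j < m" for j
      proof -
        obtain d where d: "\<forall>i<n. d i \<in> \<rat>" "c j = (\<Sum>i<n. d i * u i)" using u c j by blast
        have "d i * (u i * v j) \<in> rat_vs.span T" if i: "i < n" for i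
        proof -
          obtain q where "d i = of_rat q" using d(1) i by (auto simp: Rats_def)
          moreover have "u i * v j \<in> T" using i j by (auto simp: T_def)
          ultimately show ?thesis
            using rat_vs.span_scale[OF rat_vs.span_base, of "u i * v j" T q] by simp
        qed
        then show ?thesis
          unfolding d(2) sum_distrib_right by (auto simp: mult.assoc intro!: rat_vs.span_sum)
      qed
      then show "x \<in> rat_vs.span T" unfolding c(2) by (auto intro!: rat_vs.span_sum)
    qed
  qed
qed

lemma finite_field_extension_self:
  fixes L :: "'a::field_char_0 set"
  assumes "number_field L"
  shows "finite_field_extension L L"
proof -
  interpret A: field "ring_of_type_algebra :: 'a ring" ..
  have L: "subfield L ring_of_type_algebra" using assms by (simp add: number_field_def)
  then show ?thesis
    using A.dimension_one[OF L] A.finite_dimensionI unfolding finite_field_extension_def by blast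
qed

lemma subring_integers_of:
  fixes K :: "'a::field_char_0 set"
  assumes "subring_set K"
  shows "subring_set (integers_of K)"
proof -
  interpret subring_set K by fact
  interpret Z: subring_set "{x :: 'a. algebraic_int x}" by (rule subring_algebraic_int)
  show ?thesis
    using one_mem diff_mem mult_mem Z.diff_mem Z.mult_mem
    by unfold_locales (auto simp: integers_of_def)
qed

lemma finite_residues_integers_of:
  fixes L M :: "'a::field_char_0 set"
  assumes "number_field L" "finite_field_extension L M" "m > 0"
  shows "finite_residues (integers_of M) m"
proof -
  obtain T where T: "finite T" "M \<subseteq> rat_vs.span T"
    using finite_rational_span[OF assms(1,2)] .
  have "subring_set M"
    using assms(2) subfield_subring_set by (auto simp: finite_field_extension_def)
  then show ?thesis
    using T assms(3) by (intro finite_residues_all[OF subring_integers_of, of M T])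
      (auto simp: integers_of_def)
qed

section \<open>Residue rings of ideals\<close>

lemma (in ideal_set) freshman_dream:
  assumes p: "Factorial_Ring.prime p" "of_nat p \<in> I" and xy: "x \<in> R" "y \<in> R"
  shows "(x + y) ^ p - (x ^ p + y ^ p) \<in> I"
proof -
  have p0: "p > 0" using p(1) prime_gt_0_nat by blast
  define f where "f k = of_nat (p choose k) * x ^ k * y ^ (p - k)" for k
  have "{..p} = insert 0 (insert p {0<..<p})" using p0 by auto
  then have "(x + y) ^ p = f 0 + (f p + sum f {0<..<p})"
    unfolding binomial_ring f_def[symmetric] using p0 by simp
  then have "(x + y) ^ p - (x ^ p + y ^ p) = sum f {0<..<p}"
    by (simp add: f_def)
  also have "\<dots> \<in> I"
  proof (rule I_sum)
    fix k assume "k \<in> {0<..<p}"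
    then have "p dvd (p choose k)"
      using p(1) by (intro dvd_choose_prime) auto
    then obtain m where "p choose k = m * p" by (auto simp: dvd_def mult.commute)
    then have "f k = (of_nat m * x ^ k * y ^ (p - k)) * of_nat p"
      by (simp add: f_def)
    then show "f k \<in> I"
      using xy p(2) by (auto intro!: I_absorb mult_mem of_nat_mem power_mem)
  qed
  finally show ?thesis .
qed

lemma (in ideal_set) freshman_dream_sum:
  assumes p: "Factorial_Ring.prime p" "of_nat p \<in> I" and f: "\<And>i. i \<in> A \<Longrightarrow> f i \<in> R"
  shows "(sum f A) ^ p - (\<Sum>i\<in>A. f i ^ p) \<in> I"
  using f
proof (induction A rule: infinite_finite_induct)
  case (insert a A)
  have "(sum f (insert a A)) ^ p - (\<Sum>i\<in>insert a A. f i ^ p)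
    = ((f a + sum f A) ^ p - (f a ^ p + sum f A ^ p)) + (sum f A ^ p - (\<Sum>i\<in>A. f i ^ p))"
    using insert.hyps by simp
  also have "\<dots> \<in> I"
    using insert by (intro I_add freshman_dream p sum_mem) auto
  finally show ?case .
qed (use p(1) prime_gt_0_nat in \<open>auto simp: I_zero power_0_left\<close>)

lemma (in ideal_set) freshman_dream_diff_power:
  assumes p: "Factorial_Ring.prime p" "of_nat p \<in> I" and xy: "x \<in> R" "y \<in> R"
  shows "(x - y) ^ (p ^ n) - (x ^ (p ^ n) - y ^ (p ^ n)) \<in> I"
proof (induction n)
  case 0
  then show ?case by (simp add: I_zero)
next
  case (Suc n)
  let ?q = "p ^ n"
  define a b c where "a = (x - y) ^ ?q" and "b = x ^ ?q" and "c = y ^ ?q"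
  have abc: "a \<in> R" "b \<in> R" "c \<in> R"
    using xy by (auto simp: a_def b_def c_def intro!: power_mem diff_mem)
  have "a ^ p - (b - c) ^ p \<in> I"
    using Suc abc by (intro power_diff_mem diff_mem) (auto simp: a_def b_def c_def)
  \<comment> \<open>Splitting \<open>b\<close> as \<open>(b - c) + c\<close> gives the rule for
    differences from the one for sums, without meeting the sign of \<open>(- c) ^ p\<close>.\<close>
  moreover have "((b - c) + c) ^ p - ((b - c) ^ p + c ^ p) \<in> I"
    using abc by (intro freshman_dream p diff_mem)
  ultimately have "(a ^ p - (b - c) ^ p) - (((b - c) + c) ^ p - ((b - c) ^ p + c ^ p)) \<in> I"
    by (rule I_diff)
  then have "a ^ p - (b ^ p - c ^ p) \<in> I"
    by (simp add: algebra_simps)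
  then show ?case
    by (simp add: a_def b_def c_def power_mult[symmetric] mult.commute)
qed

text \<open>Finiteness of \<open>R/pR\<close> together with \<open>p\<close> in \<open>I\<close>
  does the work usually done by the Dedekind property.\<close>

locale residue_ideal = ideal_set R I for R :: "'a::field_char_0 set" and I +
  fixes p :: nat
  assumes p_prime: "Factorial_Ring.prime p" and p_mem: "of_nat p \<in> I" and proper: "1 \<notin> I"
    and residues: "finite_residues R p"
begin

definition pR :: "'a set" where "pR = {of_nat p * r | r. r \<in> R}"

lemma pR_ideal: "ideal_set R pR"
proof (intro ideal_set.intro subring_set_axioms ideal_set_axioms.intro)
  fix r x assume "r \<in> R" "x \<in> pR"
  then obtain s where "s \<in> R" "x = of_nat p * s" by (auto simp: pR_def)
  then show "r * x \<in> pR" 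
    using \<open>r \<in> R\<close> mult_mem unfolding pR_def by (intro CollectI exI[of _ "r * s"]) (auto simp: ac_simps)
next
  fix x y assume "x \<in> pR" "y \<in> pR"
  then show "x + y \<in> pR"
    by (auto simp: pR_def distrib_left[symmetric] intro: add_mem)
qed (auto simp: pR_def intro: mult_mem of_nat_mem zero_mem exI[of _ 0])

lemma pR_subset: "pR \<subseteq> I"
  using I_absorb'[OF _ p_mem] by (auto simp: pR_def)

lemma residue_pigeonhole:
  assumes "\<And>n::nat. f n \<in> R"
  shows "\<exists>i j. i < j \<and> f i - f j \<in> pR"
proof -
  interpret J: ideal_set R pR by (rule pR_ideal)
  obtain F where F: "finite F" "\<forall>x\<in>R. \<exists>a\<in>F. \<exists>r\<in>R. x = a + of_nat p * r"
    using residues unfolding finite_residues_def by blast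
  have "\<forall>n. \<exists>a\<in>F. f n - a \<in> pR"
  proof
    fix n
    obtain a r where "a \<in> F" "r \<in> R" "f n = a + of_nat p * r" using F(2) assms[of n] by blast
    then show "\<exists>a\<in>F. f n - a \<in> pR" by (intro bexI[of _ a]) (auto simp: pR_def)
  qed
  then obtain g where g: "\<And>n. g n \<in> F" "\<And>n. f n - g n \<in> pR" by metis
  have "\<not> inj g"
    using F(1) g(1) by (metis finite_subset image_subset_iff infinite_UNIV_nat finite_imageD)
  then obtain i j where ij: "g i = g j" "i \<noteq> j" by (auto simp: inj_def)
  have *: "f i - f j \<in> pR" "f j - f i \<in> pR"
    using J.I_diff[OF g(2)[of i] g(2)[of j]] J.I_diff[OF g(2)[of j] g(2)[of i]] ij(1) by auto
  show ?thesis
    using * ij(2) by (metis linorder_neqE_nat)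
qed

text \<open>Two powers of \<open>q\<close> agree modulo \<open>p\<close> by pigeonhole. For
  \<open>q\<close> in \<open>I\<close> the factor \<open>1 - q ^ k\<close> is 1 modulo
  \<open>I\<close> and annihilates a power of \<open>q\<close>; for \<open>q\<close> outside a prime
  \<open>I\<close> the same relation makes \<open>q ^ k\<close> equal to 1 modulo
  \<open>I\<close>.\<close>

lemma power_cycle:
  assumes "q \<in> R"
  shows "\<exists>i k. k > 0 \<and> q ^ i * (1 - q ^ k) \<in> pR"
proof -
  obtain i j where "i < j" "q ^ i - q ^ j \<in> pR"
    using residue_pigeonhole[of "\<lambda>n. q ^ n"] assms power_mem by blast
  moreover have "q ^ j = q ^ i * q ^ (j - i)"
    using \<open>i < j\<close> by (simp add: power_add[symmetric])
  ultimately show ?thesis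
    by (intro exI[of _ i] exI[of _ "j - i"]) (auto simp: algebra_simps)
qed

text \<open>The witness is a product of factors \<open>1 - q ^ k\<close>, one for each
  \<open>q\<close> in \<open>G\<close>. Being 1 modulo \<open>I\<close> is what later keeps it out
  of \<open>pR\<close>.\<close>

lemma annihilates_powers:
  assumes "finite G" "G \<subseteq> I"
  shows "\<exists>b\<in>R. 1 - b \<in> I \<and> (\<forall>q\<in>G. \<exists>n. b * q ^ n \<in> pR)"
  using assms
proof (induction G rule: finite_induct)
  case empty
  then show ?case using one_mem I_zero by (intro bexI[of _ 1]) auto
next
  case (insert q G)
  interpret J: ideal_set R pR by (rule pR_ideal)
  obtain b where b: "b \<in> R" "1 - b \<in> I" "\<forall>q\<in>G. \<exists>n. b * q ^ n \<in> pR"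
    using insert by auto
  have qI: "q \<in> I" and qR: "q \<in> R" using insert I_subset by auto
  obtain i k where k: "k > 0" "q ^ i * (1 - q ^ k) \<in> pR"
    using power_cycle[OF qR] by blast
  define c where "c = b * (1 - q ^ k)"
  have sR: "1 - q ^ k \<in> R" using qR by (intro diff_mem one_mem power_mem)
  have qk: "q ^ k \<in> I"
    using k(1) qI qR by (cases k) (auto intro: I_absorb' power_mem)
  have "c \<in> R" unfolding c_def using b sR by (intro mult_mem)
  moreover have "1 - c = (1 - b) + b * q ^ k" by (simp add: c_def algebra_simps)
  then have "1 - c \<in> I" using b qk I_add I_absorb by metis
  moreover have "\<exists>n. c * x ^ n \<in> pR" if x: "x \<in> insert q G" for x
  proof (cases "x = q")
    case True
    have "c * q ^ i = b * (q ^ i * (1 - q ^ k))" by (simp add: c_def ac_simps)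
    then show ?thesis using True k b J.I_absorb by metis
  next
    case False
    then obtain n where "b * x ^ n \<in> pR" using b(3) x by blast
    from J.I_absorb[OF sR this] have "c * x ^ n \<in> pR" by (simp add: c_def ac_simps)
    then show ?thesis by blast
  qed
  ultimately show ?case by blast
qed

text \<open>Passes from killing a power of each \<open>q\<close> to killing each \<open>q\<close>
  itself: multiply by the last power of \<open>q\<close> that does not yet give zero modulo
  \<open>p\<close>.\<close>

lemma annihilates_from_powers:
  assumes "finite G" "G \<subseteq> R" "b \<in> R" "b \<notin> pR" "\<forall>q\<in>G. \<exists>n. b * q ^ n \<in> pR"
  shows "\<exists>s\<in>R. s * b \<notin> pR \<and> (\<forall>q\<in>G. s * b * q \<in> pR)"
  using assms
proof (induction G rule: finite_induct)
  case empty
  then show ?case using one_mem by (intro bexI[of _ 1]) auto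
next
  case (insert q G)
  interpret J: ideal_set R pR by (rule pR_ideal)
  obtain s where s: "s \<in> R" "s * b \<notin> pR" "\<forall>q\<in>G. s * b * q \<in> pR"
    using insert by auto
  have qR: "q \<in> R" using insert by auto
  obtain n where "b * q ^ n \<in> pR" using insert.prems by auto
  then have "s * (b * q ^ n) \<in> pR" using s(1) by (rule J.I_absorb[rotated])
  then have ex: "\<exists>n. s * b * q ^ n \<in> pR" by (auto simp: mult.assoc)
  \<comment> \<open>The least exponent is positive because \<open>s * b\<close> is outside
    \<open>pR\<close>; its predecessor \<open>l\<close> supplies the new multiplier
    \<open>s * q ^ l\<close>.\<close>
  define m where "m = (LEAST n. s * b * q ^ n \<in> pR)"
  have m: "s * b * q ^ m \<in> pR" unfolding m_def using ex by (rule LeastI_ex)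
  then have "m \<noteq> 0" using s by (intro notI) auto
  then obtain l where l: "m = Suc l" by (cases m) auto
  then have nl: "s * b * q ^ l \<notin> pR" 
    using not_less_Least[of l "\<lambda>n. s * b * q ^ n \<in> pR"] by (simp add: m_def)
  have "s * q ^ l \<in> R" using s qR by (intro mult_mem power_mem)
  moreover have "s * q ^ l * b \<notin> pR" using nl by (simp add: ac_simps)
  moreover have "s * q ^ l * b * x \<in> pR" if x: "x \<in> insert q G" for x
  proof (cases "x = q")
    case True
    then show ?thesis using m l by (simp add: ac_simps)
  next
    case False
    then have "s * b * x \<in> pR" using s(3) x by blast
    then have "q ^ l * (s * b * x) \<in> pR" by (rule J.I_absorb[OF power_mem[OF qR]])
    then show ?thesis by (simp add: ac_simps)
  qed
  ultimately show ?case by blast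
qed

text \<open>In the finite ring \<open>R/pR\<close> a proper ideal is annihilated by a nonzero element \<open>b\<close>;
  then \<open>b/p\<close> is an element of the inverse ideal outside \<open>R\<close>.\<close>

lemma inverse_ideal_element:
  obtains b where "b \<in> R" "b / of_nat p \<notin> R" "\<And>q. q \<in> I \<Longrightarrow> b / of_nat p * q \<in> R"
proof -
  interpret J: ideal_set R pR by (rule pR_ideal)
  have p0: "(of_nat p :: 'a) \<noteq> 0" using p_prime by (auto dest: prime_gt_0_nat)
  obtain F where F: "finite F" "F \<subseteq> R" "\<forall>x\<in>R. \<exists>a\<in>F. \<exists>r\<in>R. x = a + of_nat p * r"
    using residues unfolding finite_residues_def by blast
  \<comment> \<open>Representatives lying in \<open>I\<close> are enough: an element of
    \<open>I\<close> differs from its representative by an element of \<open>pR\<close>, which is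
    contained in \<open>I\<close>.\<close>
  obtain c where c: "c \<in> R" "1 - c \<in> I" "\<forall>q\<in>F \<inter> I. \<exists>n. c * q ^ n \<in> pR"
    using annihilates_powers[of "F \<inter> I"] F(1) by auto
  have "c \<notin> pR" 
  proof
    assume "c \<in> pR"
    then have "(1 - c) + c \<in> I" using pR_subset c(2) by (intro I_add) auto
    then show False using proper by simp
  qed
  then obtain s where s: "s \<in> R" "s * c \<notin> pR" "\<forall>q\<in>F \<inter> I. s * c * q \<in> pR"
    using annihilates_from_powers[of "F \<inter> I" c] F c by auto
  define b where "b = s * c"
  have b: "b \<in> R" unfolding b_def using s c by (intro mult_mem)
  have iff: "x / of_nat p \<in> R \<longleftrightarrow> x \<in> pR" for x
    using p0 by (auto simp: pR_def intro!: exI[of _ "x / of_nat p"])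
  have "b / of_nat p * q \<in> R" if q: "q \<in> I" for q
  proof -
    have qR: "q \<in> R" using q I_subset by blast
    then obtain a r where a: "a \<in> F" "r \<in> R" "q = a + of_nat p * r" using F by blast
    have "of_nat p * r \<in> pR" using a by (auto simp: pR_def)
    moreover have "a = q - of_nat p * r" using a by simp
    ultimately have "a \<in> F \<inter> I" using a(1) pR_subset q I_diff by (metis Int_iff subsetD)
    then have "b * a + b * (of_nat p * r) \<in> pR"
      using s(3) J.I_add J.I_absorb[OF b \<open>of_nat p * r \<in> pR\<close>] by (simp add: b_def)
    then have "b * q \<in> pR" by (simp add: a(3) distrib_left)
    then show ?thesis using iff[of "b * q"] by simp
  qed
  then show ?thesis using that[OF b] iff[of b] s(2) by (auto simp: b_def)
qed

end

locale residue_prime = residue_ideal +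
  assumes prime: "x \<in> R \<Longrightarrow> y \<in> R \<Longrightarrow> x * y \<in> I \<Longrightarrow> x \<in> I \<or> y \<in> I"
begin

lemma prime_power: "x \<in> R \<Longrightarrow> x ^ n \<in> I \<Longrightarrow> x \<in> I"
proof (induction n)
  case (Suc n)
  then show ?case using prime[of x "x ^ n"] power_mem by auto
qed (use proper in auto)

text \<open>\<open>R/I\<close> is a finite domain, so \<open>c ^ k\<close> is 1 modulo
  \<open>I\<close> for some positive \<open>k\<close>, and \<open>c ^ (k - 1)\<close> is the
  inverse.\<close>

lemma inverse_mod:
  assumes c: "c \<in> R" "c \<notin> I"
  shows "\<exists>d\<in>R. c * d - 1 \<in> I"
proof -
  obtain i k where k: "k > 0" "c ^ i * (1 - c ^ k) \<in> pR" using power_cycle[OF c(1)] by blast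
  have "1 - c ^ k \<in> I"
    using prime[of "c ^ i" "1 - c ^ k"] k pR_subset c prime_power[of c i]
    by (auto intro: power_mem diff_mem one_mem)
  then have "- (1 - c ^ k) \<in> I" by (rule I_uminus)
  moreover obtain l where "k = Suc l" using k by (cases k) auto
  ultimately show ?thesis using c by (intro bexI[of _ "c ^ l"] power_mem) auto
qed

text \<open>The residue field is perfect: iterated \<open>p\<close>-th powers of \<open>c\<close>
  repeat modulo \<open>I\<close>, and since the Frobenius map is injective on a domain,
  \<open>c\<close> itself is congruent to one of its later iterates.\<close>

lemma frobenius_surj_mod:
  assumes c: "c \<in> R"
  shows "\<exists>d\<in>R. c - d ^ p \<in> I"
proof -
  obtain i j where ij: "i < j" "c ^ (p ^ i) - c ^ (p ^ j) \<in> pR"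
    using residue_pigeonhole[of "\<lambda>n. c ^ (p ^ n)"] c power_mem by blast
  \<comment> \<open>One less than the gap, so that \<open>e = c ^ (p ^ (j - i))\<close> is visibly
    the \<open>p\<close>-th power of \<open>c ^ (p ^ l)\<close>.\<close>
  define l where "l = j - i - 1"
  have j: "j = Suc l + i" using ij by (simp add: l_def)
  define e where "e = c ^ (p ^ Suc l)"
  have e: "e \<in> R" unfolding e_def by (intro power_mem c)
  have ej: "e ^ (p ^ i) = c ^ (p ^ j)"
    unfolding e_def j by (simp only: power_mult[symmetric] power_add)
  have "(c - e) ^ (p ^ i) - (c ^ (p ^ i) - e ^ (p ^ i)) \<in> I"
    using c e by (intro freshman_dream_diff_power p_prime p_mem)
  moreover have "c ^ (p ^ i) - e ^ (p ^ i) \<in> I" using ij pR_subset ej by auto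
  ultimately have "((c - e) ^ (p ^ i) - (c ^ (p ^ i) - e ^ (p ^ i))) + (c ^ (p ^ i) - e ^ (p ^ i)) \<in> I"
    by (rule I_add)
  then have "(c - e) ^ (p ^ i) \<in> I" by simp
  then have "c - e \<in> I" by (rule prime_power[OF diff_mem[OF c e]])
  moreover have "e = (c ^ (p ^ l)) ^ p"
    by (simp add: e_def power_mult[symmetric] mult.commute)
  ultimately show ?thesis using c power_mem by blast
qed

end

text \<open>An ideal maximal among those that contain \<open>J\<close> but not 1 is prime. Zorn's
  lemma is used since the ring of all algebraic integers, to which this is applied, is not
  noetherian.\<close>

lemma prime_ideal_exists:
  fixes S :: "'a::idom set"
  assumes "ideal_set S J" "1 \<notin> J"
  obtains Q where "ideal_set S Q" "J \<subseteq> Q" "1 \<notin> Q"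
    "\<And>x y. x \<in> S \<Longrightarrow> y \<in> S \<Longrightarrow> x * y \<in> Q \<Longrightarrow> x \<in> Q \<or> y \<in> Q"
proof -
  interpret J: ideal_set S J by fact
  define Fam where "Fam = {Q. ideal_set S Q \<and> J \<subseteq> Q \<and> 1 \<notin> Q}"
  have "\<Union>C \<in> Fam" if C: "C \<noteq> {}" "subset.chain Fam C" for C
  proof -
    have CX: "C \<subseteq> Fam" and lin: "\<And>A B. A \<in> C \<Longrightarrow> B \<in> C \<Longrightarrow> A \<subseteq> B \<or> B \<subseteq> A"
      using C(2) by (auto simp: subset_chain_def)
    have id: "\<And>A. A \<in> C \<Longrightarrow> ideal_set S A" using CX by (auto simp: Fam_def)
    have "ideal_set S (\<Union>C)"
    proof (intro ideal_set.intro J.subring_set_axioms ideal_set_axioms.intro)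
      show "\<Union>C \<subseteq> S" using id ideal_set.I_subset by blast
      show "0 \<in> \<Union>C" using C(1) id ideal_set.I_zero by blast
      show "x + y \<in> \<Union>C" if "x \<in> \<Union>C" "y \<in> \<Union>C" for x y
      proof -
        from that obtain A B where AB: "A \<in> C" "x \<in> A" "B \<in> C" "y \<in> B" by blast
        then obtain D where "D \<in> C" "x \<in> D" "y \<in> D" using lin[of A B] by blast
        then show ?thesis using ideal_set.I_add[OF id] by blast
      qed
      show "r * x \<in> \<Union>C" if "r \<in> S" "x \<in> \<Union>C" for r x
        using that ideal_set.I_absorb[OF id] by blast
    qed
    then show ?thesis using CX C(1) by (auto simp: Fam_def)
  qed
  moreover have "Fam \<noteq> {}" using assms by (auto simp: Fam_def)
  ultimately obtain Q where Q: "Q \<in> Fam" "\<And>Q'. Q' \<in> Fam \<Longrightarrow> Q \<subseteq> Q' \<Longrightarrow> Q' = Q"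
    using subset_Zorn_nonempty[of Fam] by blast
  interpret Q: ideal_set S Q using Q by (simp add: Fam_def)
  show ?thesis
  proof (rule that)
    show "ideal_set S Q" "J \<subseteq> Q" "1 \<notin> Q" using Q by (auto simp: Fam_def)
    fix x y assume xy: "x \<in> S" "y \<in> S" "x * y \<in> Q"
    show "x \<in> Q \<or> y \<in> Q"
    proof (rule ccontr)
      assume n: "\<not> (x \<in> Q \<or> y \<in> Q)"
      \<comment> \<open>The ideal generated by \<open>Q\<close> and \<open>x\<close>. By maximality
        it contains 1, and multiplying that equation by \<open>y\<close> puts \<open>y\<close> into
        \<open>Q\<close>.\<close>
      define Q' where "Q' = {q + x * s | q s. q \<in> Q \<and> s \<in> S}"
      have "ideal_set S Q'"
      proof (intro ideal_set.intro J.subring_set_axioms ideal_set_axioms.intro)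
        show "Q' \<subseteq> S" using Q.I_subset xy(1) by (auto simp: Q'_def intro!: J.add_mem J.mult_mem)
        show "0 \<in> Q'" unfolding Q'_def using Q.I_zero J.zero_mem by force
        fix u v assume "u \<in> Q'" "v \<in> Q'"
        then obtain a b c d where "u = a + x * b" "v = c + x * d" "a \<in> Q" "b \<in> S" "c \<in> Q" "d \<in> S"
          unfolding Q'_def by blast
        then show "u + v \<in> Q'" unfolding Q'_def
          by (intro CollectI exI[of _ "a + c"] exI[of _ "b + d"])
            (auto simp: algebra_simps intro: Q.I_add J.add_mem)
      next
        fix r u assume r: "r \<in> S" "u \<in> Q'"
        then obtain a b where "u = a + x * b" "a \<in> Q" "b \<in> S"
          unfolding Q'_def by blast
        moreover from this have "r * u = r * a + x * (r * b)" by (simp add: algebra_simps)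
        ultimately show "r * u \<in> Q'"
          unfolding Q'_def using r Q.I_absorb J.mult_mem by blast
      qed
      moreover have sub: "Q \<subseteq> Q'"
        unfolding Q'_def using J.zero_mem by force
      moreover have "x \<in> Q'"
        unfolding Q'_def using Q.I_zero J.one_mem by (intro CollectI exI[of _ 0] exI[of _ 1]) auto
      ultimately have "1 \<in> Q'"
        using Q(2)[of Q'] n Q(1) unfolding Fam_def by blast
      then obtain q s where qs: "1 = q + x * s" "q \<in> Q" "s \<in> S" unfolding Q'_def by blast
      have "y = y * (q + x * s)" using qs(1) by simp
      also have "\<dots> = y * q + s * (x * y)" by (simp add: algebra_simps)
      also have "\<dots> \<in> Q" 
        by (rule Q.I_add[OF Q.I_absorb[OF xy(2) qs(2)] Q.I_absorb[OF qs(3) xy(3)]])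
      finally show False using n by blast
    qed
  qed
qed

section \<open>The resultant as a product over roots\<close>

lemma poly_eq_sum_lessThan:
  fixes f :: "'a::comm_semiring_1 poly"
  assumes "degree f < n"
  shows "poly f x = (\<Sum>k<n. coeff f k * x ^ k)"
proof -
  have "poly f x = (\<Sum>k\<le>degree f. coeff f k * x ^ k)" by (rule poly_altdef)
  also have "\<dots> = (\<Sum>k<n. coeff f k * x ^ k)"
    using assms by (intro sum.mono_neutral_left) (auto simp: coeff_eq_0 not_le)
  finally show ?thesis .
qed

text \<open>A Vandermonde matrix with its powers in descending order, to match the Sylvester matrix.
  A kernel vector of the transpose would be the coefficient list of a nonzero polynomial of degree
  below \<open>n\<close> with \<open>n\<close> roots.\<close>

lemma det_power_mat_nonzero:
  fixes a :: "nat \<Rightarrow> 'a::field"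
  assumes inj: "inj_on a {..<n}"
  shows "det (mat n n (\<lambda>(i, k). a k ^ (n - Suc i))) \<noteq> 0"
proof
  define A where "A = mat n n (\<lambda>(k, i). a k ^ (n - Suc i))"
  have A: "A \<in> carrier_mat n n" by (simp add: A_def)
  have tr: "mat n n (\<lambda>(i, k). a k ^ (n - Suc i)) = transpose_mat A"
    by (rule eq_matI) (auto simp: A_def)
  assume "det (mat n n (\<lambda>(i, k). a k ^ (n - Suc i))) = 0"
  then have "det A = 0" unfolding tr using det_transpose[OF A] by simp
  then obtain v where v: "v \<in> carrier_vec n" "v \<noteq> 0\<^sub>v n" "A *\<^sub>v v = 0\<^sub>v n"
    using det_0_iff_vec_prod_zero_field[OF A] by auto
  define q where "q = (\<Sum>i<n. monom (v $ (n - Suc i)) i)"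
  have co: "coeff q i = (if i < n then v $ (n - Suc i) else 0)" for i
    unfolding q_def by (simp add: coeff_sum)
  have root: "poly q (a k) = 0" if k: "k < n" for k
  proof -
    have "poly q (a k) = (\<Sum>i<n. v $ (n - Suc i) * a k ^ i)"
      by (simp add: q_def poly_sum poly_monom)
    also have "\<dots> = (\<Sum>i<n. v $ (n - Suc (n - Suc i)) * a k ^ (n - Suc i))"
      by (rule sum.nat_diff_reindex[symmetric])
    also have "\<dots> = (\<Sum>i<n. a k ^ (n - Suc i) * v $ i)"
      by (intro sum.cong) (auto simp: Suc_diff_Suc)
    also have "\<dots> = (A *\<^sub>v v) $ k"
      using k v(1) by (simp add: A_def scalar_prod_def lessThan_atLeast0)
    finally show ?thesis using v(3) k by simp
  qed
  have n: "n > 0" using v by (intro Nat.gr0I) auto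
  have "degree q < n"
    using n co by (intro degree_lessI) auto
  then have "q = 0"
    using root n card_image[OF inj] by (intro poly_eqI_degree[of "a ` {..<n}"]) auto
  then have "v $ i = 0" if "i < n" for i
    using co[of "n - Suc i"] that by (auto simp: Suc_diff_Suc)
  then have "v = 0\<^sub>v n" using v(1) by (intro eq_vecI) auto
  then show False using v(2) by simp
qed

text \<open>Multiplying the Sylvester matrix from the right by the matrix \<open>V\<close> below, whose columns are
  the functionals ``coefficient of degree at least \<open>n\<close>'' and ``evaluation at \<open>a k\<close>'',
  makes it block triangular.\<close>

lemma resultant_eq_prod_roots:
  fixes a :: "nat \<Rightarrow> 'a::field" and g :: "'a poly"
  assumes inj: "inj_on a {..<n}" and f: "f = (\<Prod>i<n. [:- a i, 1:])"
  shows "resultant f g = (\<Prod>i<n. poly g (a i))"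
proof -
  define m where "m = degree g"
  have deg_f: "degree f = n" 
    unfolding f by (simp add: degree_prod_sum_eq)
  have lc_f: "lead_coeff f = 1"
    unfolding f lead_coeff_prod by simp
  have f_root: "poly f (a k) = 0" if "k < n" for k
    unfolding f poly_prod using that by (auto intro!: bexI[of _ k])
  define S where "S = sylvester_mat f g"
  have S: "S \<in> carrier_mat (m + n) (m + n)"
    using sylvester_carrier_mat[of f g] by (simp add: S_def m_def deg_f add.commute)
  \<comment> \<open>Row \<open>i\<close> of the Sylvester matrix lists the coefficients of this
    polynomial from degree \<open>m + n - 1\<close> downwards.\<close>
  define row_poly where "row_poly i = (if i < m then monom 1 (m - Suc i) * f else monom 1 (m + n - Suc i) * g)" for i
  have S_index: "S $$ (i, j) = coeff (row_poly i) (m + n - Suc j)" if ij: "i < m + n" "j < m + n" for i j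
  proof -
    have "S $$ (i, j) = (if i < m then if i \<le> j \<and> j - i \<le> n then coeff f (n + i - j) else 0
     else if i - m \<le> j \<and> j \<le> i then coeff g (i - j) else 0)"
      using sylvester_index_mat[of i f g j] ij by (simp add: S_def m_def deg_f add.commute)
    moreover have "coeff g k = 0" if "k > m" for k
      using that by (simp add: coeff_eq_0 m_def)
    moreover have "coeff f k = 0" if "k > n" for k
      using that by (simp add: coeff_eq_0 deg_f)
    ultimately show ?thesis
      using ij by (auto simp: row_poly_def coeff_monom_mult intro!: arg_cong[of _ _ "coeff f"] arg_cong[of _ _ "coeff g"])
  qed
  have deg_row: "degree (row_poly i) < m + n" if "i < m + n" for i
  proof -
    have "degree (monom 1 k * q) \<le> k + degree q" for k and q :: "'a poly"
      using degree_mult_le[of "monom 1 k" q] degree_monom_le[of "1::'a" k] by linarith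
    from this[of "m - Suc i" f] this[of "m + n - Suc i" g] show ?thesis
      using that by (auto simp: row_poly_def deg_f m_def)
  qed
  define A where "A = mat n n (\<lambda>(i, k). a k ^ (n - Suc i))"
  define U where "U = mat m n (\<lambda>(i, k). a k ^ (m + n - Suc i))"
  define V where "V = four_block_mat (1\<^sub>m m) U (0\<^sub>m n m) A"
  have A: "A \<in> carrier_mat n n" and U: "U \<in> carrier_mat m n" by (auto simp: A_def U_def)
  then have V: "V \<in> carrier_mat (m + n) (m + n)" by (simp add: V_def)
  have V_index: "V $$ (j, k) = (if k < m then if j = k then 1 else 0 else a (k - m) ^ (m + n - Suc j))"
    if "j < m + n" "k < m + n" for j k
    using that by (auto simp: V_def A_def U_def add.commute)
  have det_V: "det V = det A"
    unfolding V_def using det_four_block_mat_lower_left_zero[OF _ U refl A, of "1\<^sub>m m"] by simp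
  define T where "T = mat m m (\<lambda>(i, k). S $$ (i, k))"
  define B where "B = mat n m (\<lambda>(i, k). S $$ (i + m, k))"
  define W where "W = A * mat_diag n (\<lambda>k. poly g (a k))"
  have T: "T \<in> carrier_mat m m" and B: "B \<in> carrier_mat n m" by (auto simp: T_def B_def)
  have W: "W \<in> carrier_mat n n" unfolding W_def using A by simp
  have SV_index: "(S * V) $$ (i, k) = (if k < m then S $$ (i, k) else poly (row_poly i) (a (k - m)))"
    if ik: "i < m + n" "k < m + n" for i k
  proof -
    have "(S * V) $$ (i, k) = (\<Sum>j<m+n. S $$ (i, j) * V $$ (j, k))"
      using S V ik by (simp add: scalar_prod_def lessThan_atLeast0)
    also have "\<dots> = (if k < m then S $$ (i, k) else poly (row_poly i) (a (k - m)))"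
    proof (cases "k < m")
      case True
      have "(\<Sum>j<m+n. S $$ (i, j) * V $$ (j, k)) = (\<Sum>j<m+n. if j = k then S $$ (i, k) else 0)"
        using True ik by (intro sum.cong) (auto simp: V_index)
      then show ?thesis using True ik by simp
    next
      case False
      have "(\<Sum>j<m+n. S $$ (i, j) * V $$ (j, k))
        = (\<Sum>j<m+n. coeff (row_poly i) (m + n - Suc j) * a (k - m) ^ (m + n - Suc j))"
        using False ik by (intro sum.cong) (auto simp: V_index S_index)
      also have "\<dots> = (\<Sum>j<m+n. coeff (row_poly i) j * a (k - m) ^ j)"
        by (rule sum.nat_diff_reindex)
      also have "\<dots> = poly (row_poly i) (a (k - m))"
        using deg_row[OF ik(1)] by (simp add: poly_eq_sum_lessThan)
      finally show ?thesis using False by simp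
    qed
    finally show ?thesis .
  qed
  \<comment> \<open>The zero block appears because rows built from \<open>f\<close> vanish at its
    roots; rows built from \<open>g\<close> yield powers of \<open>a k\<close> times
    \<open>poly g (a k)\<close>.\<close>
  have SV: "S * V = four_block_mat T (0\<^sub>m m n) B W"
  proof (rule eq_matI)
    fix i k assume "i < dim_row (four_block_mat T (0\<^sub>m m n) B W)" "k < dim_col (four_block_mat T (0\<^sub>m m n) B W)"
    then have ik: "i < m + n" "k < m + n" using T W by auto
    have W_index: "W $$ (i', k') = a k' ^ (n - Suc i') * poly g (a k')" if "i' < n" "k' < n" for i' k'
      unfolding W_def using that mat_diag_mult_right[OF A, of "\<lambda>k. poly g (a k)"] by (simp add: A_def)
    show "(S * V) $$ (i, k) = four_block_mat T (0\<^sub>m m n) B W $$ (i, k)"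
      using ik T W f_root by (auto simp: SV_index[OF ik] T_def B_def W_index row_poly_def poly_monom
          add.commute[of n m])
  qed (use S V T W in auto)
  have det_T: "det T = 1"
  proof -
    have "upper_triangular T"
      unfolding upper_triangular_def T_def by (auto simp: S_index row_poly_def coeff_monom_mult coeff_eq_0 deg_f)
    moreover have "diag_mat T = map (\<lambda>_. 1) [0..<m]"
      unfolding diag_mat_def using T lc_f
      by (auto simp: T_def S_index row_poly_def coeff_monom_mult deg_f)
    ultimately show ?thesis using det_upper_triangular[OF _ T] by (simp add: prod_list_replicate map_replicate_const)
  qed
  have det_W: "det W = det A * (\<Prod>k<n. poly g (a k))"
  proof -
    have "det (mat_diag n (\<lambda>k. poly g (a k))) = (\<Prod>k<n. poly g (a k))"
      by (subst det_upper_triangular[of _ n])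
        (auto simp: mat_diag_def diag_mat_def prod.list_conv_set_nth lessThan_atLeast0 intro!: prod.cong)
    then show ?thesis unfolding W_def using A by (simp add: det_mult[of _ n])
  qed
  have "det S * det A = det (S * V)" using S V det_V by (simp add: det_mult[OF S V])
  also have "\<dots> = det A * (\<Prod>k<n. poly g (a k))"
    unfolding SV using det_four_block_mat_upper_right_zero[OF T refl B W] det_T det_W by simp
  \<comment> \<open>Distinctness of the roots permits cancelling \<open>det A\<close>.\<close>
  finally show ?thesis
    using det_power_mat_nonzero[OF inj] by (simp add: A_def S_def resultant_def)
qed

section \<open>Repeated factors modulo a prime\<close>

lemma lead_coeff_monic_quotient:
  fixes g q r :: "'a::idom poly"
  assumes "lead_coeff (g * q + r) = 1" "lead_coeff g = 1" "r = 0 \<or> degree r < degree g"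
    "degree g \<le> degree (g * q + r)"
  shows "lead_coeff q = 1"
proof -
  have "g \<noteq> 0" using assms(2) by auto
  have "lead_coeff (g * q) = 1"
  proof (cases "r = 0")
    case False
    have "q \<noteq> 0" using False assms(3,4) by (intro notI) auto
    then have "degree g \<le> degree (g * q)" using \<open>g \<noteq> 0\<close> by (simp add: degree_mult_eq)
    then have "degree r < degree (g * q)" using False assms(3) by simp
    then show ?thesis using assms(1) lead_coeff_add_le[of r "g * q"] by (simp add: add.commute)
  qed (use assms(1) in simp)
  then show ?thesis using assms(2) by (simp add: lead_coeff_mult)
qed

text \<open>The prime ideal \<AA> stands for the polynomials vanishing at a chosen root modulo a
  prime above \<open>I\<close>. With it, polynomial arithmetic over the residue field is done by
  congruences in \<open>R[x]\<close>.\<close>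

locale residue_prime_poly = residue_prime +
  fixes \<AA> :: "'a poly set"
  assumes A_ideal: "ideal_set (polys_over R) \<AA>"
    and A_proper: "1 \<notin> \<AA>"
    and A_prime: "f \<in> polys_over R \<Longrightarrow> g \<in> polys_over R \<Longrightarrow> f * g \<in> \<AA> \<Longrightarrow> f \<in> \<AA> \<or> g \<in> \<AA>"
    and I_polys_subset: "polys_over I \<subseteq> \<AA>"
begin

interpretation A: ideal_set "polys_over R" \<AA> by (rule A_ideal)

lemma A_prime_power: "f \<in> polys_over R \<Longrightarrow> f ^ n \<in> \<AA> \<Longrightarrow> f \<in> \<AA>"
proof (induction n)
  case (Suc n)
  then show ?case using A_prime[of f "f ^ n"] polys_power_mem by auto
qed (use A_proper in auto)

text \<open>A monic lift to \<open>R[x]\<close> of the minimal polynomial of the chosen root over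
  \<open>R/I\<close>.\<close>

definition minimal_monic :: "'a poly \<Rightarrow> bool" where
  "minimal_monic g \<longleftrightarrow> g \<in> \<AA> \<and> lead_coeff g = 1 \<and>
     (\<forall>f\<in>\<AA>. lead_coeff f = 1 \<longrightarrow> degree g \<le> degree f)"

lemma minimal_monic_exists:
  assumes "h \<in> \<AA>" "lead_coeff h = 1"
  obtains g where "minimal_monic g"
proof -
  obtain g where "g \<in> \<AA> \<and> lead_coeff g = 1"
    "\<forall>f. f \<in> \<AA> \<and> lead_coeff f = 1 \<longrightarrow> degree g \<le> degree f"
    using ex_has_least_nat[of "\<lambda>f. f \<in> \<AA> \<and> lead_coeff f = 1" h degree] assms by blast
  then show ?thesis using that[of g] by (auto simp: minimal_monic_def)
qed

text \<open>Otherwise the highest coefficient outside \<open>I\<close> could be scaled to 1 modulo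
  \<open>I\<close> and everything above it, being in \<open>I\<close>, dropped; this would leave a
  monic element of \<AA> of smaller degree.\<close>

lemma below_minimal_monic:
  assumes g: "minimal_monic g" and f: "f \<in> \<AA>" "f = 0 \<or> degree f < degree g"
  shows "f \<in> polys_over I"
proof (rule ccontr)
  assume n: "f \<notin> polys_over I"
  have fR: "f \<in> polys_over R" using f A.I_subset by blast
  have fcR: "coeff f i \<in> R" for i using fR by (simp add: polys_over_def)
  obtain i where i: "coeff f i \<notin> I" using n by (auto simp: polys_over_def)
  have bnd: "\<forall>i. coeff f i \<notin> I \<longrightarrow> i \<le> degree f"
    using I_zero le_degree by metis
  define d where "d = (GREATEST i. coeff f i \<notin> I)"
  have d: "coeff f d \<notin> I"
    unfolding d_def using GreatestI_nat[of "\<lambda>i. coeff f i \<notin> I" i "degree f"] i bnd by blast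
  have above: "coeff f i \<in> I" if "i > d" for i
    using Greatest_le_nat[of "\<lambda>i. coeff f i \<notin> I" i "degree f"] bnd that
    unfolding d_def by (meson not_le)
  have dlt: "d < degree g"
    using bnd d f(2) I_zero by fastforce
  obtain e where e: "e \<in> R" "coeff f d * e - 1 \<in> I"
    using inverse_mod[OF fcR d] by blast
  \<comment> \<open>Congruent to \<open>smult e f\<close> modulo \<open>I\<close>, but with the
    coefficient at \<open>d\<close> exactly 1 and nothing above it.\<close>
  define f1 where "f1 = (\<Sum>i<d. monom (e * coeff f i) i) + monom 1 d"
  have co: "coeff f1 i = (if i < d then e * coeff f i else if i = d then 1 else 0)" for i
    by (simp add: f1_def coeff_sum)
  have "coeff (f1 - smult e f) i \<in> I" for i
  proof -
    have "coeff (f1 - smult e f) d = - (coeff f d * e - 1)" by (simp add: co algebra_simps)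
    moreover have "- (e * coeff f i) \<in> I" if "i > d"
      using above[OF that] e(1) by (intro I_uminus I_absorb)
    ultimately show ?thesis
      using I_zero I_uminus[OF e(2)] by (cases i d rule: linorder_cases) (auto simp: co mult.commute)
  qed
  then have "f1 - smult e f \<in> \<AA>" using I_polys_subset by (auto simp: polys_over_def)
  moreover have "smult e f \<in> \<AA>"
    using A.I_absorb[OF const_mem[OF e(1)] f(1)] by simp
  ultimately have "f1 - smult e f + smult e f \<in> \<AA>" by (rule A.I_add)
  then have f1A: "f1 \<in> \<AA>" by simp
  have "degree f1 = d"
    using co by (intro antisym degree_le le_degree) auto
  then have "lead_coeff f1 = 1" "degree f1 < degree g" using co[of d] dlt by auto
  then show False using g f1A by (auto simp: minimal_monic_def)
qed

text \<open>The remainder belongs to \<AA> and is smaller than \<open>g\<close>, so it vanishes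
  modulo \<open>I\<close>.\<close>

lemma minimal_monic_division:
  assumes g: "minimal_monic g" and f: "f \<in> \<AA>" "lead_coeff f = 1"
  obtains q r where "q \<in> polys_over R" "r \<in> polys_over I" "f = g * q + r" "lead_coeff q = 1"
proof -
  have gA: "g \<in> \<AA>" "lead_coeff g = 1" "degree g \<le> degree f" using g f by (auto simp: minimal_monic_def)
  have R: "g \<in> polys_over R" "f \<in> polys_over R" using gA f A.I_subset by auto
  obtain q r where qr: "q \<in> polys_over R" "r \<in> polys_over R" "f = g * q + r" "r = 0 \<or> degree r < degree g"
    using monic_division[OF R(1) gA(2) R(2)] by blast
  have "f - q * g \<in> \<AA>" using f qr gA by (intro A.I_diff A.I_absorb)
  then have "r \<in> \<AA>" using qr(3) by (simp add: mult.commute)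
  then have "r \<in> polys_over I" using below_minimal_monic[OF g] qr(4) by blast
  moreover have "lead_coeff q = 1"
    using lead_coeff_monic_quotient[of g q r] f gA qr by simp
  ultimately show ?thesis using that qr by blast
qed

lemma of_nat_not_mem:
  assumes "\<not> p dvd n"
  shows "of_nat n \<notin> I"
proof
  assume "of_nat n \<in> I"
  have "coprime (int p) (int n)" using p_prime assms by (intro prime_imp_coprime) auto
  then obtain a b where ab: "a * int p + b * int n = 1"
    using bezout_int[of "int p" "int n"] by (metis coprime_iff_gcd_eq_1)
  have "of_int a * of_nat p + of_int b * of_nat n \<in> I"
    using \<open>of_nat n \<in> I\<close> p_mem by (intro I_add I_absorb of_int_mem)
  also have "of_int a * of_nat p + of_int b * of_nat n = (of_int (a * int p + b * int n) :: 'a)" by simp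
  finally show False using ab proper by simp
qed

text \<open>If \<open>g' = 0\<close> modulo \<open>I\<close>, then \<open>g\<close> is a \<open>p\<close>-th power modulo \<open>I\<close>, since the residue field
  is perfect; this contradicts minimality.\<close>

lemma pderiv_minimal_monic:
  assumes g: "minimal_monic g"
  shows "pderiv g \<notin> \<AA>"
proof
  assume "pderiv g \<in> \<AA>"
  have gA: "g \<in> \<AA>" and lc: "lead_coeff g = 1" using g by (auto simp: minimal_monic_def)
  have gR: "coeff g i \<in> R" for i using gA A.I_subset by (auto simp: polys_over_def)
  have p2: "p > 1" using p_prime by (rule prime_gt_1_nat)
  have pos: "degree g > 0"
  proof (rule Nat.gr0I)
    assume "degree g = 0"
    then have "g = 1" using lc by (metis degree_eq_zeroE lead_coeff_pCons(2) one_pCons)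
    then show False using gA A_proper by simp
  qed
  \<comment> \<open>The derivative has degree below \<open>degree g\<close>, so minimality already
    forces all its coefficients into \<open>I\<close>; hence \<open>g\<close> is a polynomial in the
    \<open>p\<close>-th power of the variable modulo \<open>I\<close>.\<close>
  have "pderiv g \<in> polys_over I"
    using pos by (intro below_minimal_monic[OF g \<open>pderiv g \<in> \<AA>\<close>]) (auto simp: degree_pderiv)
  then have "of_nat (Suc i) * coeff g (Suc i) \<in> I" for i
    by (simp add: polys_over_def coeff_pderiv del: of_nat_Suc)
  then have ndvd: "coeff g i \<in> I" if "\<not> p dvd i" for i
    using prime[of "of_nat i" "coeff g i"] that gR of_nat_mem of_nat_not_mem
    by (cases i) (auto simp del: of_nat_Suc)
  have "p dvd degree g" using ndvd[of "degree g"] lc proper by auto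
  then obtain m where m: "degree g = p * m" by (auto simp: dvd_def)
  then have m0: "m > 0" using pos by (intro Nat.gr0I) auto
  have "\<forall>i. \<exists>d\<in>R. coeff g (p * i) - d ^ p \<in> I" using frobenius_surj_mod gR by blast
  then obtain d' where d': "\<And>i. d' i \<in> R" "\<And>i. coeff g (p * i) - d' i ^ p \<in> I" by metis
  \<comment> \<open>The root at the top index is fixed as 1 to make \<open>G\<close> monic; this is
    consistent since \<open>g\<close> has leading coefficient 1.\<close>
  define d where "d i = (if i = m then 1 else d' i)" for i
  have d: "d i \<in> R" "coeff g (p * i) - d i ^ p \<in> I" for i
    using d' one_mem I_zero lc m by (auto simp: d_def)
  define G where "G = (\<Sum>i\<le>m. monom (d i) i)"
  have co: "coeff G i = (if i \<le> m then d i else 0)" for i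
    by (simp add: G_def coeff_sum)
  have GR: "G \<in> polys_over R" using d zero_mem by (simp add: polys_over_def co)
  have "degree G = m" using co by (intro antisym degree_le le_degree) (auto simp: d_def)
  then have lcG: "lead_coeff G = 1" by (simp add: co d_def)
  \<comment> \<open>The intermediate polynomial: \<open>G ^ p\<close> is congruent to
    \<open>H\<close> by the Frobenius rule, and \<open>H\<close> to \<open>g\<close>
    coefficientwise.\<close>
  define H where "H = (\<Sum>i\<le>m. monom (d i) i ^ p)"
  have H: "H = (\<Sum>i\<le>m. monom (d i ^ p) (p * i))"
    by (simp add: H_def monom_power mult.commute)
  have "of_nat p \<in> polys_over I"
    using p_mem I_zero by (auto simp: polys_over_def of_nat_poly coeff_pCons split: nat.splits)
  then have "G ^ p - H \<in> polys_over I"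
    unfolding G_def H_def using d
    by (intro ideal_set.freshman_dream_sum[OF polys_ideal p_prime] monom_mem)
  moreover have "g - H \<in> polys_over I"
    unfolding polys_over_def
  proof (intro CollectI allI)
    fix j
    show "coeff (g - H) j \<in> I"
    proof (cases "p dvd j")
      case True
      then obtain i where j: "j = p * i" by (auto simp: dvd_def)
      have "coeff H j = (if i \<le> m then d i ^ p else 0)"
        unfolding H using p2 by (simp add: coeff_sum j)
      moreover have "coeff g j = 0" if "\<not> i \<le> m"
        using that m p2 by (intro coeff_eq_0) (simp add: j)
      ultimately show ?thesis using d(2)[of i] I_zero by (auto simp: j)
    next
      case False
      then have "coeff H j = 0" unfolding H by (auto simp: coeff_sum intro!: sum.neutral)
      then show ?thesis using ndvd[OF False] by simp
    qed
  qed
  ultimately have "(G ^ p - H) - (g - H) \<in> \<AA>"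
    using polys_I_diff I_polys_subset by blast
  then have "(G ^ p - H) - (g - H) + g \<in> \<AA>" using gA by (rule A.I_add)
  then have "G ^ p \<in> \<AA>" by simp
  then have "G \<in> \<AA>" using GR by (rule A_prime_power[rotated])
  then have "degree g \<le> degree G" using g lcG by (auto simp: minimal_monic_def)
  then show False using m m0 p2 \<open>degree G = m\<close> by simp
qed

text \<open>With \<open>h\<close> congruent to \<open>g * q\<close>, the product rule puts
  \<open>q * pderiv g\<close> into \<AA>. As \<open>pderiv g\<close> is not in \<AA>, primality
  gives \<open>q\<close> in \<AA>, and \<open>g\<close> can be divided out a second time.\<close>

lemma square_factor_mod:
  assumes h: "h \<in> \<AA>" "lead_coeff h = 1" "pderiv h \<in> \<AA>"
  obtains g k where "g \<in> polys_over R" "k \<in> polys_over R" "lead_coeff g = 1" "lead_coeff k = 1"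
    "degree g > 0" "h - g ^ 2 * k \<in> polys_over I"
proof -
  obtain g where g: "minimal_monic g" using minimal_monic_exists[OF h(1,2)] .
  have gA: "g \<in> \<AA>" "lead_coeff g = 1" using g by (auto simp: minimal_monic_def)
  have gR: "g \<in> polys_over R" using gA A.I_subset by auto
  have pos: "degree g > 0"
  proof (rule Nat.gr0I)
    assume "degree g = 0"
    then have "g = 1" using gA(2) by (metis degree_eq_zeroE lead_coeff_pCons(2) one_pCons)
    then show False using gA A_proper by simp
  qed
  obtain q r where q: "q \<in> polys_over R" "r \<in> polys_over I" "h = g * q + r" "lead_coeff q = 1"
    using minimal_monic_division[OF g h(1,2)] .
  have "pderiv r \<in> polys_over I"
    using q(2) by (auto simp: polys_over_def coeff_pderiv simp del: of_nat_Suc intro!: I_absorb of_nat_mem)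
  then have "pderiv h - pderiv r - pderiv q * g \<in> \<AA>"
    using h(3) gA(1) I_polys_subset q(1)
    by (intro A.I_diff A.I_absorb pderiv_mem) auto
  moreover have "pderiv h - pderiv r - pderiv q * g = q * pderiv g"
    by (simp add: q(3) pderiv_add pderiv_mult algebra_simps)
  ultimately have "q \<in> \<AA>"
    using A_prime[of q "pderiv g"] q(1) pderiv_mem[OF gR] pderiv_minimal_monic[OF g] by auto
  then obtain k s where k: "k \<in> polys_over R" "s \<in> polys_over I" "q = g * k + s" "lead_coeff k = 1"
    using minimal_monic_division[OF g _ q(4)] by blast
  have "h - g ^ 2 * k = g * s + r"
    by (simp add: q(3) k(3) algebra_simps power2_eq_square)
  also have "\<dots> \<in> polys_over I"
    using gR k q by (intro polys_I_add polys_I_absorb)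
  finally show ?thesis using that gR k gA pos by blast
qed

end

section \<open>Reduction modulo a prime over the algebraic closure\<close>

interpretation to_ac_hom: inj_idom_hom "to_ac :: 'a::field \<Rightarrow> 'a alg_closure"
  by unfold_locales auto

lemma map_poly_to_ac_mult:
  "map_poly to_ac (f * g) = map_poly to_ac f * map_poly to_ac g"
  by (intro poly_eqI) (simp add: coeff_mult to_ac_sum)

lemma algebraic_int_to_ac_iff [simp]:
  fixes x :: "'a::field_char_0"
  shows "algebraic_int (to_ac x) \<longleftrightarrow> algebraic_int x"
proof -
  have "map_poly of_int f = map_poly to_ac (map_poly of_int f :: 'a poly)" for f :: "int poly"
    by (intro poly_eqI) (simp add: coeff_map_poly)
  then have "poly (map_poly of_int f) (to_ac x) = 0 \<longleftrightarrow> poly (map_poly of_int f) x = 0" for f :: "int poly"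
    by (simp add: to_ac_hom.poly_map_poly)
  then show ?thesis by (simp add: algebraic_int_altdef_ipoly)
qed

lemma alg_closed_monic_split:
  fixes f :: "'a::alg_closed_field poly"
  assumes "lead_coeff f = 1"
  obtains a where "f = (\<Prod>i<degree f. [:- a i, 1:])"
proof -
  have "f \<noteq> 0" using assms by auto
  then obtain A where A: "size A = degree f" "f = (\<Prod>x\<in>#A. [:- x, 1:])"
    using alg_closed_imp_factorization[of f] assms by auto
  obtain xs where "A = mset xs" using ex_mset by metis
  then have "f = (\<Prod>x\<leftarrow>xs. [:- x, 1:])" "length xs = degree f"
    using A by (simp_all flip: prod_mset_prod_list)
  then show ?thesis
    using that[of "\<lambda>i. xs ! i"] by (simp add: prod.list_conv_set_nth lessThan_atLeast0)
qed

lemma poly_pderiv_split: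
  fixes a :: "nat \<Rightarrow> 'a::field"
  assumes "j < n"
  shows "poly (pderiv (\<Prod>i<n. [:- a i, 1:])) (a j) = (\<Prod>i\<in>{..<n} - {j}. a j - a i)"
proof -
  have "(\<Prod>i<n. [:- a i, 1:]) = [:- a j, 1:] * (\<Prod>i\<in>{..<n} - {j}. [:- a i, 1:])"
    using assms by (intro prod.remove) auto
  then have "pderiv (\<Prod>i<n. [:- a i, 1:])
    = [:- a j, 1:] * pderiv (\<Prod>i\<in>{..<n} - {j}. [:- a i, 1:]) + (\<Prod>i\<in>{..<n} - {j}. [:- a i, 1:])"
    by (simp only: pderiv_mult) (simp add: pderiv_pCons)
  then show ?thesis by (simp add: poly_prod)
qed

lemma inj_on_roots_if_separable:
  fixes a :: "nat \<Rightarrow> 'a::field"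
  assumes "\<And>j. j < n \<Longrightarrow> poly (pderiv (\<Prod>i<n. [:- a i, 1:])) (a j) \<noteq> 0"
  shows "inj_on a {..<n}"
proof (rule inj_onI, rule ccontr)
  fix i j assume ij: "i \<in> {..<n}" "j \<in> {..<n}" "a i = a j" "i \<noteq> j"
  then have "(\<Prod>l\<in>{..<n} - {j}. a j - a l) = 0"
    by (intro prod_zero) (auto intro!: bexI[of _ i])
  then show False using assms[of j] ij by (simp add: poly_pderiv_split)
qed

locale integral_residue_prime = residue_prime "integers_of K" I p for K :: "'a::field_char_0 set" and I p +
  assumes K_subfield: "subfield K ring_of_type_algebra"
begin

text \<open>The prime \<open>I\<close> survives in the ring of all algebraic integers: an element \<open>t\<close> of the inverse
  ideal that is not integral witnesses that the extended ideal is proper.\<close>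

lemma prime_over:
  obtains Q where "ideal_set {x :: 'a alg_closure. algebraic_int x} Q" "to_ac ` I \<subseteq> Q" "1 \<notin> Q"
    "\<And>x y. algebraic_int x \<Longrightarrow> algebraic_int y \<Longrightarrow> x * y \<in> Q \<Longrightarrow> x \<in> Q \<or> y \<in> Q"
proof -
  interpret Z: subring_set "{x :: 'a alg_closure. algebraic_int x}" by (rule subring_algebraic_int)
  interpret K: subring_set K by (rule subfield_subring_set[OF K_subfield])
  obtain b where b: "b \<in> integers_of K" "b / of_nat p \<notin> integers_of K"
    "\<And>q. q \<in> I \<Longrightarrow> b / of_nat p * q \<in> integers_of K"
    using inverse_ideal_element by blast
  define t where "t = b / of_nat p"
  have "t \<in> K"
    unfolding t_def divide_inverse using b(1)
    by (intro K.mult_mem subfield_inverse_mem[OF K_subfield] K.of_nat_mem) (simp add: integers_of_def)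
  then have t: "\<not> algebraic_int t" using b(2) by (simp add: integers_of_def t_def)
  \<comment> \<open>An explicit ideal containing the image of \<open>I\<close>. It omits 1 because
    \<open>t\<close> is not integral, so properness needs no analysis of sums of products.\<close>
  define J where "J = {x. algebraic_int x \<and> algebraic_int (to_ac t * x)}"
  have "ideal_set {x. algebraic_int x} J"
  proof (intro ideal_set.intro Z.subring_set_axioms ideal_set_axioms.intro)
    fix x y assume "x \<in> J" "y \<in> J"
    then show "x + y \<in> J"
      using Z.add_mem by (simp add: J_def distrib_left)
  next
    fix r x :: "'a alg_closure" assume r: "r \<in> {x. algebraic_int x}" and x: "x \<in> J"
    have "algebraic_int (r * (to_ac t * x))" using r x by (auto simp: J_def intro: algebraic_int_mult)
    then show "r * x \<in> J"
      using r x by (auto simp: J_def ac_simps intro: algebraic_int_mult)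
  qed (auto simp: J_def)
  moreover have "1 \<notin> J" using t by (simp add: J_def)
  ultimately obtain Q where Q: "ideal_set {x. algebraic_int x} Q" "J \<subseteq> Q" "1 \<notin> Q"
    "\<And>x y. x \<in> {x. algebraic_int x} \<Longrightarrow> y \<in> {x. algebraic_int x} \<Longrightarrow> x * y \<in> Q \<Longrightarrow> x \<in> Q \<or> y \<in> Q"
    using prime_ideal_exists by blast
  have "to_ac ` I \<subseteq> J"
  proof (intro image_subsetI)
    fix x assume x: "x \<in> I"
    have "algebraic_int x" "algebraic_int (t * x)"
      using x I_subset b(3)[OF x] by (auto simp: integers_of_def t_def)
    then show "to_ac x \<in> J"
      by (simp add: J_def flip: to_ac_mult)
  qed
  then show ?thesis using that[of Q] Q by blast
qed

lemma square_factor_mod_if_resultant_mem: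
  assumes h: "h \<in> polys_over (integers_of K)" "lead_coeff h = 1"
    and sep: "\<And>x. poly (map_poly to_ac h) x = 0 \<Longrightarrow> poly (map_poly to_ac (pderiv h)) x \<noteq> 0"
    and res: "resultant h (pderiv h) \<in> I"
  obtains g k where "g \<in> polys_over (integers_of K)" "k \<in> polys_over (integers_of K)"
    "lead_coeff g = 1" "lead_coeff k = 1" "degree g > 0" "h - g ^ 2 * k \<in> polys_over I"
proof -
  let ?\<phi> = "map_poly to_ac :: 'a poly \<Rightarrow> 'a alg_closure poly"
  let ?Z = "{x :: 'a alg_closure. algebraic_int x}"
  interpret Z: subring_set ?Z by (rule subring_algebraic_int)
  obtain Q where Q: "ideal_set ?Z Q" "to_ac ` I \<subseteq> Q" "1 \<notin> Q"
    and Q_prime: "\<And>x y. algebraic_int x \<Longrightarrow> algebraic_int y \<Longrightarrow> x * y \<in> Q \<Longrightarrow> x \<in> Q \<or> y \<in> Q"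
    using prime_over by blast
  interpret Q: ideal_set ?Z Q by fact
  define n where "n = degree h"
  have lc_h: "lead_coeff (?\<phi> h) = 1" and "degree (?\<phi> h) = n" using h(2) by (auto simp: n_def)
  then obtain a where a: "?\<phi> h = (\<Prod>i<n. [:- a i, 1:])"
    using alg_closed_monic_split by metis
  have root: "poly (?\<phi> h) (a i) = 0" if "i < n" for i
    unfolding a poly_prod using that by (auto intro!: bexI[of _ i])
  \<comment> \<open>The product formula for the resultant is for distinct roots; \<open>sep\<close>
    provides this.\<close>
  have "inj_on a {..<n}"
    using inj_on_roots_if_separable[of n a] sep root by (simp add: to_ac_hom.map_poly_pderiv a)
  then have "resultant (?\<phi> h) (?\<phi> (pderiv h)) = (\<Prod>i<n. poly (?\<phi> (pderiv h)) (a i))"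
    using a by (rule resultant_eq_prod_roots)
  then have "(\<Prod>i<n. poly (?\<phi> (pderiv h)) (a i)) = to_ac (resultant h (pderiv h))"
    by (simp add: to_ac_hom.resultant_hom)
  then have prod_Q: "(\<Prod>i<n. poly (?\<phi> (pderiv h)) (a i)) \<in> Q" using res Q(2) by auto
  have coeff_Z: "?\<phi> f \<in> polys_over ?Z" if "f \<in> polys_over (integers_of K)" for f
    using that by (auto simp: polys_over_def integers_of_def)
  have a_Z: "algebraic_int (a i)" if "i < n" for i
  proof (rule algebraic_int_root_of_monic[OF lc_h root[OF that]])
    show "algebraic_int (coeff (?\<phi> h) k)" for k
      using coeff_Z[OF h(1)] unfolding polys_over_def by blast
  qed
  have eval_Z: "algebraic_int (poly (?\<phi> f) (a i))" if "f \<in> polys_over (integers_of K)" "i < n" for f i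
    using Z.poly_mem[OF coeff_Z[OF that(1)], of "a i"] a_Z[OF that(2)] by simp
  have "\<exists>i<m. poly (?\<phi> (pderiv h)) (a i) \<in> Q"
    if "m \<le> n" "(\<Prod>i<m. poly (?\<phi> (pderiv h)) (a i)) \<in> Q" for m
    using that
  proof (induction m)
    case (Suc m)
    have "algebraic_int (poly (?\<phi> (pderiv h)) (a i))" if "i < Suc m" for i
      using that Suc.prems(1) h(1) by (intro eval_Z pderiv_mem) auto
    moreover from this have "algebraic_int (\<Prod>i<m. poly (?\<phi> (pderiv h)) (a i))"
      using Z.prod_mem[of "{..<m}" "\<lambda>i. poly (?\<phi> (pderiv h)) (a i)"] by auto
    ultimately have "(\<Prod>i<m. poly (?\<phi> (pderiv h)) (a i)) \<in> Q \<or> poly (?\<phi> (pderiv h)) (a m) \<in> Q"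
      using Suc.prems(2) by (intro Q_prime) auto
    then show ?case using Suc by (auto simp: less_Suc_eq)
  qed (use Q(3) in simp)
  from this[OF le_refl prod_Q] obtain i where i: "i < n" "poly (?\<phi> (pderiv h)) (a i) \<in> Q" by blast
  \<comment> \<open>Both \<open>h\<close> and its derivative lie here: the first because
    \<open>a i\<close> is a root, the second by the choice of \<open>i\<close>.\<close>
  define \<AA> where "\<AA> = {f \<in> polys_over (integers_of K). poly (?\<phi> f) (a i) \<in> Q}"
  interpret A: residue_prime_poly "integers_of K" I p \<AA>
  proof (intro residue_prime_poly.intro residue_prime_axioms residue_prime_poly_axioms.intro)
    show "ideal_set (polys_over (integers_of K)) \<AA>"
      using Q.I_zero Q.I_add Q.I_absorb eval_Z[OF _ i(1)]
      by (intro ideal_set.intro polys_subring ideal_set_axioms.intro)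
        (auto simp: \<AA>_def hom_distribs map_poly_to_ac_mult
          intro: polys_zero_mem polys_add_mem polys_mult_mem)
    show "1 \<notin> \<AA>" using Q(3) by (simp add: \<AA>_def)
    fix f g assume "f \<in> polys_over (integers_of K)" "g \<in> polys_over (integers_of K)" "f * g \<in> \<AA>"
    then show "f \<in> \<AA> \<or> g \<in> \<AA>"
      using Q_prime[OF eval_Z[OF _ i(1)] eval_Z[OF _ i(1)], of f g]
      by (auto simp: \<AA>_def hom_distribs map_poly_to_ac_mult)
  next
    show "polys_over I \<subseteq> \<AA>"
    proof
      fix f assume f: "f \<in> polys_over I"
      have "poly (?\<phi> f) (a i) \<in> Q"
        unfolding poly_altdef using f Q(2) a_Z[OF i(1)]
        by (intro Q.I_sum Q.I_absorb' Z.power_mem) (auto simp: polys_over_def)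
      then show "f \<in> \<AA>" using f polys_over_mono[OF I_subset] by (auto simp: \<AA>_def)
    qed
  qed
  show ?thesis
    using A.square_factor_mod[of h] that h i root pderiv_mem[OF h(1)] Q.I_zero
    by (auto simp: \<AA>_def)
qed

end

section \<open>Simple extensions and the conductor\<close>

lemma ring_of_type_algebra_simps [simp]:
  "carrier ring_of_type_algebra = UNIV" "x \<otimes>\<^bsub>ring_of_type_algebra\<^esub> y = x * y"
  "x \<oplus>\<^bsub>ring_of_type_algebra\<^esub> y = x + y" "\<one>\<^bsub>ring_of_type_algebra\<^esub> = 1" "\<zero>\<^bsub>ring_of_type_algebra\<^esub> = 0"
  by (simp_all add: ring_of_type_algebra_def)

lemma ring_of_type_algebra_a_inv [simp]:
  fixes x :: "'a::comm_ring_1"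
  shows "\<ominus>\<^bsub>ring_of_type_algebra\<^esub> x = - x"
proof -
  interpret A: cring "ring_of_type_algebra :: 'a ring" ..
  show ?thesis using A.minus_equality[of "- x" x] by simp
qed

lemma irreducible_over_factor:
  fixes h :: "'a::idom poly"
  assumes S: "subring_set S" and irr: "irreducible_over S h"
    and ab: "a \<in> polys_over S" "b \<in> polys_over S" "h = a * b"
  shows "(\<exists>c\<in>polys_over S. a = h * c) \<or> (\<exists>c\<in>polys_over S. a * c = 1)"
proof -
  let ?R = "ring_on (polys_over S)"
  have irr': "irreducible ?R h" using irr by (simp add: irreducible_over_def ring_irreducible_def)
  have "a divides\<^bsub>?R\<^esub> h" using ab by (auto simp: factor_def)
  then have "h divides\<^bsub>?R\<^esub> a \<or> a \<in> Units ?R"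
    using irreducibleD[OF irr' _ , of a] ab by (auto simp: properfactor_def)
  then show ?thesis by (auto simp: factor_def Units_def mult.commute)
qed

text \<open>The ideal generated by \<open>h\<close> and \<open>f\<close> in \<open>K[x]\<close> is
  principal, and its generator divides the irreducible \<open>h\<close>. The division is carried out
  inside \<open>polys_over K\<close> because the quotient and the Bezout factors must have
  coefficients in \<open>K\<close>, not merely in the ambient field.\<close>

lemma irreducible_over_bezout:
  fixes h :: "'a::field_char_0 poly"
  assumes K: "subfield K ring_of_type_algebra" and irr: "irreducible_over K h" and f: "f \<in> polys_over K"
  shows "(\<exists>q\<in>polys_over K. f = h * q) \<or> (\<exists>u\<in>polys_over K. \<exists>v\<in>polys_over K. u * h + v * f = 1)"
proof -
  interpret subring_set K by (rule subfield_subring_set[OF K])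
  have h: "h \<in> polys_over K" "h \<noteq> 0"
    using irr by (auto simp: irreducible_over_def ring_irreducible_def)
  define N where "N = {u * h + v * f | u v. u \<in> polys_over K \<and> v \<in> polys_over K}"
  have N_R: "N \<subseteq> polys_over K" unfolding N_def using h f by (auto intro!: polys_add_mem polys_mult_mem)
  have hN: "h \<in> N" unfolding N_def using polys_one_mem polys_zero_mem
    by (intro CollectI exI[of _ 1] exI[of _ 0]) auto
  have fN: "f \<in> N" unfolding N_def using polys_one_mem polys_zero_mem
    by (intro CollectI exI[of _ 0] exI[of _ 1]) auto
  have N_sub: "w - w' * q \<in> N" if w: "w \<in> N" "w' \<in> N" "q \<in> polys_over K" for w w' q
  proof -
    obtain u v u' v' where uv: "w = u * h + v * f" "w' = u' * h + v' * f"
      "u \<in> polys_over K" "v \<in> polys_over K" "u' \<in> polys_over K" "v' \<in> polys_over K"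
      using w unfolding N_def by blast
    have "w - w' * q = (u - u' * q) * h + (v - v' * q) * f"
      by (simp add: uv algebra_simps)
    moreover have "u - u' * q \<in> polys_over K" "v - v' * q \<in> polys_over K"
      using uv w(3) by (auto intro!: polys_diff_mem polys_mult_mem)
    ultimately show ?thesis unfolding N_def by blast
  qed
  obtain d0 where d0: "d0 \<in> N \<and> d0 \<noteq> 0" "\<forall>w. w \<in> N \<and> w \<noteq> 0 \<longrightarrow> degree d0 \<le> degree w"
    using ex_has_least_nat[of "\<lambda>w. w \<in> N \<and> w \<noteq> 0" h degree] hN h by blast
  define d where "d = smult (inverse (lead_coeff d0)) d0"
  have inv: "inverse (lead_coeff d0) \<in> K"
    using d0 N_R by (intro subfield_inverse_mem[OF K]) (auto simp: polys_over_def)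
  have d: "lead_coeff d = 1" "degree d = degree d0" using d0 by (auto simp: d_def)
  \<comment> \<open>\<open>N_sub\<close> provides closure in the form \<open>w - w' * q\<close>
    only: zero is obtained as \<open>h - h * 1\<close>, and scaling \<open>d0\<close> as subtraction
    from zero of \<open>d0\<close> times a negated constant.\<close>
  have dN: "d \<in> N"
    using N_sub[of 0 d0 "[:- inverse (lead_coeff d0):]"] N_sub[OF hN hN polys_one_mem] d0 inv
    by (auto simp: d_def const_mem uminus_mem)
  have dvd: "\<exists>q\<in>polys_over K. w = d * q" if w: "w \<in> N" for w
  proof -
    obtain q r where qr: "q \<in> polys_over K" "r \<in> polys_over K" "w = d * q + r" "r = 0 \<or> degree r < degree d"
      using monic_division[OF _ d(1), of w] dN N_R w by blast
    have "w - d * q \<in> N" using N_sub w dN qr(1) by blast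
    then have "r \<in> N" using qr(3) by simp
    then have "r = 0" using d0(2) d(2) qr(4) by force
    then show ?thesis using qr by auto
  qed
  obtain q q' where q: "q \<in> polys_over K" "h = d * q" and q': "q' \<in> polys_over K" "f = d * q'"
    using dvd hN fN by meson
  have dR: "d \<in> polys_over K" using dN N_R by blast
  from irreducible_over_factor[OF subring_set_axioms irr dR q] show ?thesis
  proof
    assume "\<exists>c\<in>polys_over K. d = h * c"
    then obtain c where c: "c \<in> polys_over K" "d = h * c" by blast
    have "f = h * (c * q')" using c q' by (simp add: mult.assoc)
    then show ?thesis using polys_mult_mem[OF c(1) q'(1)] by blast
  next
    assume "\<exists>c\<in>polys_over K. d * c = 1"
    then obtain c where c: "c \<in> polys_over K" "d * c = 1" by blast
    obtain u v where uv: "u \<in> polys_over K" "v \<in> polys_over K" "d = u * h + v * f"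
      using dN unfolding N_def by blast
    have "(c * u) * h + (c * v) * f = 1" using c(2) uv(3) by (simp add: algebra_simps)
    then show ?thesis using polys_mult_mem[OF c(1)] uv by blast
  qed
qed

lemma adjoin_ring_eq:
  fixes A :: "'a::field_char_0 set"
  assumes "subring_set A"
  shows "adjoin_ring A x = {poly f x | f. f \<in> polys_over A}"
proof
  interpret subring_set A by fact
  show "adjoin_ring A x \<subseteq> {poly f x | f. f \<in> polys_over A}"
  proof
    fix y assume "y \<in> adjoin_ring A x"
    then show "y \<in> {poly f x | f. f \<in> polys_over A}"
      unfolding adjoin_ring_def
    proof (induction rule: generate_ring.induct)
      case one
      then show ?case using polys_one_mem by (intro CollectI exI[of _ 1]) auto
    next
      case (incl h)
      show ?case
      proof (cases "h = x")
        case True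
        then show ?thesis
          using zero_mem one_mem polys_zero_mem by (intro CollectI exI[of _ "[:0, 1:]"]) (auto intro!: pCons_mem)
      next
        case False
        then show ?thesis
          using incl by (intro CollectI exI[of _ "[:h:]"]) (auto intro!: const_mem)
      qed
    next
      case (a_inv h)
      then obtain f where "f \<in> polys_over A" "h = poly f x" by blast
      then show ?case
        using polys_diff_mem[OF polys_zero_mem] by (intro CollectI exI[of _ "0 - f"]) auto
    next
      case (eng_add h1 h2)
      then obtain f g where "f \<in> polys_over A" "h1 = poly f x" "g \<in> polys_over A" "h2 = poly g x" by blast
      then show ?case
        using polys_add_mem by (intro CollectI exI[of _ "f + g"]) auto
    next
      case (eng_mult h1 h2)
      then obtain f g where "f \<in> polys_over A" "h1 = poly f x" "g \<in> polys_over A" "h2 = poly g x" by blast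
      then show ?case
        using polys_mult_mem by (intro CollectI exI[of _ "f * g"]) auto
    qed
  qed
  let ?G = "generate_ring (ring_of_type_algebra :: 'a ring) (insert x A)"
  have incl: "y \<in> ?G" if "y \<in> insert x A" for y using that by (rule generate_ring.incl)
  have add: "y + z \<in> ?G" and mult: "y * z \<in> ?G" if "y \<in> ?G" "z \<in> ?G" for y z
    using generate_ring.eng_add[OF that] generate_ring.eng_mult[OF that] by simp_all
  have "f \<in> polys_over A \<Longrightarrow> poly f x \<in> ?G" for f
  proof (induction f)
    case 0
    then show ?case using incl zero_mem by simp
  next
    case (pCons a f)
    have all: "coeff (pCons a f) i \<in> A" for i using pCons.prems unfolding polys_over_def by blast
    have a: "a \<in> A" using all[of 0] by simp
    have "coeff f i \<in> A" for i using all[of "Suc i"] by simp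
    then have f: "f \<in> polys_over A" by (simp add: polys_over_def)
    show ?case using a pCons.IH[OF f] incl add mult by simp
  qed
  then show "{poly f x | f. f \<in> polys_over A} \<subseteq> adjoin_ring A x" by (auto simp: adjoin_ring_def)
qed

text \<open>Factors \<open>x\<close> are cancelled from a monic integer equation until its constant
  term is nonzero; that term is then an integral multiple of \<open>x\<close>.\<close>

lemma algebraic_int_divides_integer:
  fixes x :: "'a::field_char_0"
  assumes "algebraic_int x" "x \<noteq> 0"
  obtains m :: int and y where "m \<noteq> 0" "algebraic_int y" "x * y = of_int m"
proof -
  interpret Z: subring_set "{x :: 'a. algebraic_int x}" by (rule subring_algebraic_int)
  obtain f where f: "poly (map_poly of_int f) x = 0" "lead_coeff f = (1 :: int)"
    using assms(1) by (auto simp: algebraic_int_altdef_ipoly)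
  have "\<exists>m y. m \<noteq> 0 \<and> algebraic_int y \<and> x * y = of_int m"
    using f
  proof (induction f)
    case (pCons c f)
    have val: "of_int c + x * poly (map_poly of_int f) x = 0"
      using pCons.prems by (simp add: of_int_hom.map_poly_pCons_hom)
    show ?case
    proof (cases "c = 0")
      case True
      then have "f \<noteq> 0" using pCons.hyps by auto
      then show ?thesis using pCons.IH pCons.prems val True assms(2) by simp
    next
      case False
      have "map_poly of_int f \<in> polys_over {x :: 'a. algebraic_int x}"
        by (auto simp: polys_over_def coeff_map_poly intro: int_imp_algebraic_int)
      then have "- poly (map_poly of_int f) x \<in> {x. algebraic_int x}"
        using assms(1) by (intro Z.uminus_mem Z.poly_mem) auto
      moreover have "x * - poly (map_poly of_int f) x = of_int c"
        using val by (simp add: add_eq_0_iff)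
      ultimately show ?thesis using False by blast
    qed
  qed simp
  then show ?thesis using that by blast
qed

locale simple_extension_root =
  fixes K :: "'a::field_char_0 set" and h :: "'a poly" and \<eta> :: 'a
  assumes subfield: "subfield K ring_of_type_algebra" and irr: "irreducible_over K h"
    and monic: "lead_coeff h = 1" and root: "poly h \<eta> = 0"
begin

sublocale subring_set K by (rule subfield_subring_set[OF subfield])

lemma h_mem: "h \<in> polys_over K"
  using irr by (simp add: irreducible_over_def)

lemma degree_pos: "degree h > 0"
proof (rule Nat.gr0I)
  assume "degree h = 0"
  then have "h = 1" using monic by (metis degree_eq_zeroE lead_coeff_pCons(2) one_pCons)
  then show False using root by simp
qed

lemma root_imp_multiple:
  assumes "f \<in> polys_over K" "poly f \<eta> = 0"
  obtains q where "q \<in> polys_over K" "f = h * q"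
proof -
  have "\<not> (u * h + v * f = 1)" for u v
  proof
    assume "u * h + v * f = 1"
    then have "poly (u * h + v * f) \<eta> = 1" by simp
    then show False using assms(2) root by simp
  qed
  then show ?thesis using irreducible_over_bezout[OF subfield irr assms(1)] that by blast
qed

lemma root_imp_zero:
  assumes "f \<in> polys_over K" "poly f \<eta> = 0" "degree f < degree h"
  shows "f = 0"
proof -
  obtain q where q: "f = h * q" using root_imp_multiple[OF assms(1,2)] .
  then show ?thesis using assms(3) degree_mult_eq[of h q] degree_pos by (cases "q = 0") auto
qed

text \<open>In characteristic 0 the derivative is nonzero and of smaller degree, so it satisfies a
  Bezout relation with \<open>h\<close>. The relation survives passage to the algebraic closure,
  where all conjugates of \<eta> are available.\<close>

lemma separable:
  assumes "poly (map_poly to_ac h) x = 0"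
  shows "poly (map_poly to_ac (pderiv h)) x \<noteq> 0"
proof -
  have d: "pderiv h \<in> polys_over K" by (rule pderiv_mem[OF h_mem])
  have "pderiv h \<noteq> 0" using degree_pos by (simp add: pderiv_eq_0_iff)
  then have "pderiv h \<noteq> h * q" for q
    using degree_pos degree_mult_eq[of h q] degree_pderiv[of h] by (cases "q = 0") auto
  then obtain u v where "u * h + v * pderiv h = 1"
    using irreducible_over_bezout[OF subfield irr d] by blast
  then have "map_poly to_ac (u * h + v * pderiv h) = 1" by simp
  then have "map_poly to_ac u * map_poly to_ac h + map_poly to_ac v * map_poly to_ac (pderiv h) = 1"
    by (simp add: to_ac_hom.map_poly_hom_add map_poly_to_ac_mult)
  then have "poly (map_poly to_ac u * map_poly to_ac h + map_poly to_ac v * map_poly to_ac (pderiv h)) x = 1"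
    by simp
  then show ?thesis using assms by auto
qed

text \<open>Polynomial values are already closed under inversion: the Bezout relation with
  \<open>h\<close>, evaluated at \<eta>, exhibits the inverse.\<close>

lemma adjoin_field_eq: "adjoin_field K \<eta> = {poly f \<eta> | f. f \<in> polys_over K}"
proof
  show "adjoin_field K \<eta> \<subseteq> {poly f \<eta> | f. f \<in> polys_over K}"
  proof
    fix y assume "y \<in> adjoin_field K \<eta>"
    then show "y \<in> {poly f \<eta> | f. f \<in> polys_over K}"
      unfolding adjoin_field_def
    proof (induction rule: generate_field.induct)
      case one
      then show ?case using polys_one_mem by (intro CollectI exI[of _ 1]) auto
    next
      case (incl y)
      then have "y \<in> adjoin_ring K \<eta>" unfolding adjoin_ring_def by (rule generate_ring.incl)
      then show ?case by (simp add: adjoin_ring_eq[OF subring_set_axioms])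
    next
      case (a_inv y)
      then obtain f where "f \<in> polys_over K" "y = poly f \<eta>" by blast
      then show ?case
        using polys_diff_mem[OF polys_zero_mem] by (intro CollectI exI[of _ "0 - f"]) auto
    next
      case (m_inv y)
      then obtain f where f: "f \<in> polys_over K" "y = poly f \<eta>" and y: "y \<noteq> 0" by auto
      have "f \<noteq> h * q" for q using f y root by auto
      then obtain u v where uv: "v \<in> polys_over K" "u * h + v * f = 1"
        using irreducible_over_bezout[OF subfield irr f(1)] by blast
      have "poly (u * h + v * f) \<eta> = 1" using uv by simp
      then have "poly v \<eta> * y = 1" using f root by simp
      then have "inverse y = poly v \<eta>" using y by (metis inverse_unique mult.commute)
      then show ?case using uv ring_of_type_algebra_inverse[OF y] by auto
    next
      case (eng_add y z)
      then obtain f g where "f \<in> polys_over K" "y = poly f \<eta>" "g \<in> polys_over K" "z = poly g \<eta>" by blast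
      then show ?case
        using polys_add_mem by (intro CollectI exI[of _ "f + g"]) auto
    next
      case (eng_mult y z)
      then obtain f g where "f \<in> polys_over K" "y = poly f \<eta>" "g \<in> polys_over K" "z = poly g \<eta>" by blast
      then show ?case
        using polys_mult_mem by (intro CollectI exI[of _ "f * g"]) auto
    qed
  qed
  have "y \<in> adjoin_field K \<eta>" if "y \<in> adjoin_ring K \<eta>" for y
    using that unfolding adjoin_ring_def adjoin_field_def
    by (induction rule: generate_ring.induct) (blast intro: generate_field.intros)+
  then show "{poly f \<eta> | f. f \<in> polys_over K} \<subseteq> adjoin_field K \<eta>"
    using adjoin_ring_eq[OF subring_set_axioms, of \<eta>] by blast
qed

lemma adjoin_field_reduced:
  assumes "x \<in> adjoin_field K \<eta>"
  obtains f where "f \<in> polys_over K" "degree f < degree h" "x = poly f \<eta>"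
proof -
  obtain f where f: "f \<in> polys_over K" "x = poly f \<eta>" using assms by (auto simp: adjoin_field_eq)
  obtain q r where "q \<in> polys_over K" "r \<in> polys_over K" "f = h * q + r" "r = 0 \<or> degree r < degree h"
    using monic_division[OF h_mem monic f(1)] by blast
  then show ?thesis using that[of r] f degree_pos root by auto
qed

text \<open>Lagrange interpolation at the conjugates of \<open>\<eta>\<close>: the discriminant of \<open>h\<close>, and hence
  some positive integer, clears all denominators of an integral element.\<close>

lemma conductor:
  assumes h: "h \<in> polys_over (integers_of K)"
  obtains m :: int where "m \<noteq> 0"
    "\<And>f. f \<in> polys_over K \<Longrightarrow> degree f < degree h \<Longrightarrow> algebraic_int (poly f \<eta>) \<Longrightarrow>
       smult (of_int m) f \<in> polys_over (integers_of K)"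
proof -
  let ?\<phi> = "map_poly to_ac :: 'a poly \<Rightarrow> 'a alg_closure poly"
  let ?Z = "{x :: 'a alg_closure. algebraic_int x}"
  interpret Z: subring_set ?Z by (rule subring_algebraic_int)
  define n where "n = degree h"
  have n: "n > 0" using degree_pos by (simp add: n_def)
  have lc_h: "lead_coeff (?\<phi> h) = 1" and "degree (?\<phi> h) = n" using monic by (auto simp: n_def)
  then obtain a where a: "?\<phi> h = (\<Prod>i<n. [:- a i, 1:])"
    using alg_closed_monic_split by metis
  have rt: "poly (?\<phi> h) (a i) = 0" if "i < n" for i
    unfolding a poly_prod using that by (auto intro!: bexI[of _ i])
  define b where "b i = poly (?\<phi> (pderiv h)) (a i)" for i
  have b0: "b i \<noteq> 0" if "i < n" for i using separable[OF rt[OF that]] by (simp add: b_def)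
  have b_eq: "b i = poly (pderiv (\<Prod>i<n. [:- a i, 1:])) (a i)" for i
    by (simp add: b_def to_ac_hom.map_poly_pderiv a)
  have inj: "inj_on a {..<n}"
    using inj_on_roots_if_separable[of n a] b0 by (simp add: b_eq)
  have a_Z: "a i \<in> ?Z" if "i < n" for i
  proof -
    have "algebraic_int (coeff (?\<phi> h) k)" for k
      using h by (simp add: polys_over_def integers_of_def)
    then show ?thesis using algebraic_int_root_of_monic[OF lc_h rt[OF that]] by simp
  qed
  have "?\<phi> (pderiv h) \<in> polys_over ?Z"
    unfolding to_ac_hom.map_poly_pderiv using h
    by (intro Z.pderiv_mem) (simp add: polys_over_def integers_of_def)
  then have b_Z: "b i \<in> ?Z" if "i < n" for i
    unfolding b_def using a_Z[OF that] by (rule Z.poly_mem)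
  define d where "d = (\<Prod>i<n. b i)"
  have "algebraic_int d" "d \<noteq> 0"
    using Z.prod_mem[of "{..<n}" b] b_Z b0 by (auto simp: d_def)
  then obtain m :: int and e where m: "m \<noteq> 0" "algebraic_int e" "d * e = of_int m"
    using algebraic_int_divides_integer by blast
  \<comment> \<open>Lagrange numerators; \<open>l j\<close> takes the value \<open>b j\<close> at
    \<open>a j\<close>. The matching factor \<open>c j\<close> is \<open>d\<close> divided by
    \<open>b j\<close>, written as a product to remain visibly integral.\<close>
  define l where "l j = (\<Prod>i\<in>{..<n} - {j}. [:- a i, 1:])" for j
  define c where "c j = (\<Prod>i\<in>{..<n} - {j}. b i)" for j
  have l_Z: "l j \<in> polys_over ?Z" for j
    unfolding l_def using a_Z by (intro Z.polys_prod_mem Z.pCons_mem Z.polys_zero_mem Z.uminus_mem Z.one_mem) auto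
  have c_Z: "c j \<in> ?Z" for j
    unfolding c_def using b_Z by (intro Z.prod_mem) auto
  have l_self: "poly (l i) (a i) = b i" if "i < n" for i
    using poly_pderiv_split[OF that, of a] by (simp add: b_eq l_def poly_prod)
  have l_other: "poly (l j) (a i) = 0" if "i < n" "j \<noteq> i" for i j
    unfolding l_def poly_prod using that by (intro prod_zero) (auto intro!: bexI[of _ i])
  have deg_l: "degree (l j) < n" if "j < n" for j
    unfolding l_def using that by (subst degree_prod_sum_eq) auto
  have "smult (of_int m) f \<in> polys_over (integers_of K)"
    if f: "f \<in> polys_over K" "degree f < degree h" "algebraic_int (poly f \<eta>)" for f
  proof -
    define y where "y i = poly (?\<phi> f) (a i)" for i
    obtain w :: "int poly" where w: "poly (map_poly of_int w) (poly f \<eta>) = 0" "lead_coeff w = 1"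
      using f(3) by (auto simp: algebraic_int_altdef_ipoly)
    \<comment> \<open>An integral equation \<open>w\<close> for \<open>poly f \<eta>\<close> makes
      the composite of \<open>w\<close> and \<open>f\<close> vanish at \<eta>, hence divisible by
      \<open>h\<close>. So \<open>w\<close> also annihilates the values of \<open>f\<close> at all
      conjugates.\<close>
    have pc: "map_poly of_int w \<circ>\<^sub>p f \<in> polys_over K"
      unfolding pcompose_altdef using f(1)
      by (intro subring_set.poly_mem[OF polys_subring])
        (auto simp: polys_over_def[of "polys_over K"] coeff_map_poly intro!: const_mem of_int_mem)
    have "poly (map_poly of_int w \<circ>\<^sub>p f) \<eta> = 0" using w by (simp add: poly_pcompose)
    then obtain q where q: "map_poly of_int w \<circ>\<^sub>p f = h * q"
      using root_imp_multiple[OF pc] by blast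
    have y_Z: "y i \<in> ?Z" if "i < n" for i
    proof -
      have "map_poly to_ac (map_poly of_int w) = (map_poly of_int w :: 'a alg_closure poly)"
        by (intro poly_eqI) (simp add: coeff_map_poly)
      then have "map_poly of_int w \<circ>\<^sub>p ?\<phi> f = ?\<phi> (map_poly of_int w \<circ>\<^sub>p f)"
        by (simp add: to_ac_hom.map_poly_pcompose)
      also have "\<dots> = ?\<phi> h * ?\<phi> q" by (simp add: q map_poly_to_ac_mult)
      finally have "poly (map_poly of_int w \<circ>\<^sub>p ?\<phi> f) (a i) = poly (?\<phi> h * ?\<phi> q) (a i)" by simp
      then have "poly (map_poly of_int w) (y i) = 0"
        using rt[OF that] by (simp add: poly_pcompose y_def)
      then show ?thesis using w(2) by (auto simp: algebraic_int_altdef_ipoly)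
    qed
    \<comment> \<open>Interpolates \<open>d\<close> times \<open>f\<close>: at \<open>a i\<close>
      only the term \<open>y i * c i * b i\<close>, which is \<open>d * y i\<close>,
      survives.\<close>
    define g where "g = (\<Sum>j<n. smult (y j * c j) (l j))"
    have g_Z: "g \<in> polys_over ?Z"
      unfolding g_def using y_Z c_Z l_Z by (intro Z.polys_sum_mem Z.smult_mem Z.mult_mem) auto
    have "smult d (?\<phi> f) = g"
    proof (rule poly_eqI_degree[of "a ` {..<n}"])
      have crd: "card (a ` {..<n}) = n" using card_image[OF inj] by simp
      show "degree (smult d (?\<phi> f)) < card (a ` {..<n})"
        using f(2) \<open>d \<noteq> 0\<close> unfolding crd by (simp add: n_def)
      have "degree g \<le> n - 1"
        unfolding g_def
      proof (intro degree_sum_le)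
        fix j assume "j \<in> {..<n}"
        then show "degree (smult (y j * c j) (l j)) \<le> n - 1"
          using deg_l[of j] degree_smult_le[of "y j * c j" "l j"] by simp
      qed simp
      then show "degree g < card (a ` {..<n})" using n crd by simp
      fix x assume "x \<in> a ` {..<n}"
      then obtain i where i: "i < n" "x = a i" by auto
      have "poly g x = (\<Sum>j<n. y j * c j * poly (l j) (a i))"
        by (simp add: g_def poly_sum i)
      also have "\<dots> = (\<Sum>j<n. if j = i then y i * c i * b i else 0)"
        using i l_self l_other by (intro sum.cong) auto
      also have "\<dots> = y i * (b i * c i)" using i by simp
      also have "b i * c i = d"
        unfolding d_def c_def using i by (simp add: prod.remove[of "{..<n}" i])
      finally show "poly (smult d (?\<phi> f)) x = poly g x" by (simp add: y_def i)
    qed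
    then have "smult e (smult d (?\<phi> f)) \<in> polys_over ?Z"
      using Z.smult_mem[OF _ g_Z, of e] m(2) by simp
    then have "smult (of_int m) (?\<phi> f) \<in> polys_over ?Z" using m(3) by (simp add: mult.commute)
    then have "algebraic_int (to_ac (of_int m * coeff f i))" for i
      by (simp add: polys_over_def)
    then have "algebraic_int (of_int m * coeff f i)" for i
      by (simp only: algebraic_int_to_ac_iff)
    moreover have "of_int m * coeff f i \<in> K" for i
      using f(1) by (intro mult_mem of_int_mem) (simp add: polys_over_def)
    ultimately show ?thesis by (simp add: polys_over_def integers_of_def)
  qed
  then show ?thesis using that m(1) by blast
qed

end

section \<open>Index and ramification\<close>

lemma subring_set_imp_subring:
  fixes S :: "'a::idom set"
  assumes "subring_set S"
  shows "subring S ring_of_type_algebra"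
proof -
  interpret subring_set S by fact
  interpret A: cring "ring_of_type_algebra :: 'a ring" ..
  show ?thesis
    by (rule A.subringI) (auto intro: one_mem uminus_mem mult_mem add_mem)
qed

lemma cring_ring_on:
  fixes S :: "'a::idom set"
  assumes "subring_set S"
  shows "cring (ring_on S)"
proof -
  interpret A: cring "ring_of_type_algebra :: 'a ring" ..
  show ?thesis
    using A.subcring_iff[of S] A.subcringI'[OF subring_set_imp_subring[OF assms]] by simp
qed

lemma ideal_imp_ideal_set:
  assumes S: "subring_set S" and "ideal I (ring_on S)"
  shows "ideal_set S I"
proof -
  interpret I: ideal I "ring_on S" by fact
  show ?thesis
    using I.a_subset I.I_l_closed additive_subgroup.zero_closed[OF I.additive_subgroup_axioms]
      additive_subgroup.a_closed[OF I.additive_subgroup_axioms]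
    by (intro ideal_set.intro S ideal_set_axioms.intro) auto
qed

lemma ideal_prod_subset:
  assumes S: "subring_set S" and "ideal I (ring_on S)" "ideal J (ring_on S)"
  shows "ideal_prod (ring_on S) I J \<subseteq> I" "ideal_prod (ring_on S) I J \<subseteq> J"
  using ring.ideal_prod_inter[OF cring.axioms(1)[OF cring_ring_on[OF S]] assms(2,3)] by auto

lemma prime_of_props:
  fixes K :: "'a::field_char_0 set"
  assumes K: "subring_set K" and P: "prime_of K P"
  shows "ideal P (ring_on (integers_of K))" "ideal_set (integers_of K) P" "1 \<notin> P"
    "\<And>x y. x \<in> integers_of K \<Longrightarrow> y \<in> integers_of K \<Longrightarrow> x * y \<in> P \<Longrightarrow> x \<in> P \<or> y \<in> P"
proof -
  interpret primeideal P "ring_on (integers_of K)" using P by (simp add: prime_of_def)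
  show "ideal P (ring_on (integers_of K))" by (rule ideal_axioms)
  then show "ideal_set (integers_of K) P" by (rule ideal_imp_ideal_set[OF subring_integers_of[OF K]])
  show "1 \<notin> P" using one_imp_carrier I_notcarr by auto
  show "x \<in> P \<or> y \<in> P" if "x \<in> integers_of K" "y \<in> integers_of K" "x * y \<in> P" for x y
    using I_prime[of x y] that by simp
qed

lemma lies_above_imp_mem:
  assumes "lies_above P p"
  shows "of_nat p \<in> P"
proof -
  have "of_nat p \<in> PIdl\<^bsub>ring_on \<int>\<^esub> (of_nat p)"
    unfolding cgenideal_def by (intro CollectI exI[of _ 1]) simp
  then show ?thesis using assms by (auto simp: lies_above_def)
qed

lemma prime_divides_imp_mem:
  fixes K :: "'a::field_char_0 set"
  assumes K: "subring_set K" and P: "prime_of K P" and dvd: "prime_divides K P a"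
  shows "a \<in> P"
proof -
  let ?R = "ring_on (integers_of K)"
  interpret O: subring_set "integers_of K" by (rule subring_integers_of[OF K])
  obtain J where J: "ideal J ?R" "PIdl\<^bsub>?R\<^esub> a = ideal_prod ?R P J"
    using dvd by (auto simp: prime_divides_def factor_def ideals_set_def)
  have "a \<in> PIdl\<^bsub>?R\<^esub> a"
    unfolding cgenideal_def using O.one_mem by (intro CollectI exI[of _ 1]) simp
  then show ?thesis
    using ideal_prod_subset(1)[OF O.subring_set_axioms prime_of_props(1)[OF K P] J(1)] J(2) by auto
qed

text \<open>Products of ideals lie in each factor, so the other primes and all but two copies of the
  ramified one can be discarded.\<close>

lemma ramified_imp_square:
  fixes M :: "'a::field_char_0 set"
  assumes M: "subring_set M" and P: "P \<subseteq> integers_of M" and ram: "ramified_in M P"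
  obtains Q where "prime_of M Q" "P \<subseteq> ideal_prod (ring_on (integers_of M)) Q Q"
proof -
  let ?R = "ring_on (integers_of M)"
  have O: "subring_set (integers_of M)" by (rule subring_integers_of[OF M])
  interpret R: cring ?R by (rule cring_ring_on[OF O])
  interpret I: comm_monoid "ideals_set ?R" by (rule R.ideals_set_is_comm_monoid)
  obtain S :: "'a set set" and e :: "'a set \<Rightarrow> nat" and Q where S: "finite S" "\<And>Q. Q \<in> S \<Longrightarrow> prime_of M Q"
    and eq: "Idl\<^bsub>?R\<^esub> P = (\<Otimes>\<^bsub>ideals_set ?R\<^esub>Q\<in>S. Q [^]\<^bsub>ideals_set ?R\<^esub> e Q)"
    and Q: "Q \<in> S" "e Q > 1"
    using ram unfolding ramified_in_def by blast
  have car: "carrier (ideals_set ?R) = {I. ideal I ?R}" and mul: "I \<otimes>\<^bsub>ideals_set ?R\<^esub> J = ideal_prod ?R I J" for I J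
    by (simp_all add: ideals_set_def)
  have mem: "Q' \<in> carrier (ideals_set ?R)" if "Q' \<in> S" for Q'
    using prime_of_props(1)[OF M S(2)[OF that]] car by simp
  define J where "J = (\<Otimes>\<^bsub>ideals_set ?R\<^esub>Q\<in>S - {Q}. Q [^]\<^bsub>ideals_set ?R\<^esub> e Q)"
  have J: "J \<in> carrier (ideals_set ?R)"
    unfolding J_def by (intro I.finprod_closed) (auto intro: mem)
  have "Idl\<^bsub>?R\<^esub> P = (\<Otimes>\<^bsub>ideals_set ?R\<^esub>Q\<in>insert Q (S - {Q}). Q [^]\<^bsub>ideals_set ?R\<^esub> e Q)"
    using eq Q(1) by (simp add: insert_absorb)
  also have "\<dots> = Q [^]\<^bsub>ideals_set ?R\<^esub> e Q \<otimes>\<^bsub>ideals_set ?R\<^esub> J"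
    unfolding J_def using S(1) Q(1) mem by (intro I.finprod_insert) auto
  also have "\<dots> \<subseteq> Q [^]\<^bsub>ideals_set ?R\<^esub> e Q"
    using J I.nat_pow_closed[OF mem[OF Q(1)], of "e Q"]
    unfolding mul car by (intro ideal_prod_subset(1)[OF O]) auto
  finally have sub1: "Idl\<^bsub>?R\<^esub> P \<subseteq> Q [^]\<^bsub>ideals_set ?R\<^esub> e Q" .
  define k where "k = e Q - 2"
  have k: "e Q = Suc (Suc k)" using Q(2) by (simp add: k_def)
  have "Q [^]\<^bsub>ideals_set ?R\<^esub> e Q = ideal_prod ?R (Q [^]\<^bsub>ideals_set ?R\<^esub> k) (ideal_prod ?R Q Q)"
    unfolding k I.nat_pow_Suc mul[symmetric] using mem[OF Q(1)] by (intro I.m_assoc I.nat_pow_closed)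
  also have "\<dots> \<subseteq> ideal_prod ?R Q Q"
    using I.nat_pow_closed[OF mem[OF Q(1)], of k] I.m_closed[OF mem[OF Q(1)] mem[OF Q(1)]]
    unfolding mul car by (intro ideal_prod_subset(2)[OF O]) auto
  finally have "Idl\<^bsub>?R\<^esub> P \<subseteq> ideal_prod ?R Q Q" using sub1 by blast
  moreover have "P \<subseteq> Idl\<^bsub>?R\<^esub> P" using P by (intro R.genideal_self) simp
  ultimately show ?thesis using that S(2) Q(1) by blast
qed

text \<open>Elements of the product ideal are sums of products \<open>i * j\<close>, and each of the
  two factors absorbs one \<open>t\<close>.\<close>

lemma square_clears_ideal_prod:
  assumes S: "subring_set S" and t: "\<And>q. q \<in> Q \<Longrightarrow> t * q \<in> S" and r: "r \<in> ideal_prod (ring_on S) Q Q"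
  shows "t * t * r \<in> S"
  using r
proof (induction rule: ideal_prod.induct)
  case (prod i j)
  have "(t * i) * (t * j) \<in> S" by (rule subring_set.mult_mem[OF S t[OF prod(1)] t[OF prod(2)]])
  then show ?case by (simp add: ac_simps)
next
  case (sum s1 s2)
  then show ?case using subring_set.add_mem[OF S] by (simp add: distrib_left)
qed

section \<open>Counting additive cosets of a subring\<close>

lemma additive_cosets_eq_iff:
  fixes S B :: "'a::idom set"
  assumes S: "subring_set S" and B: "subring_set B" "B \<subseteq> S" and xy: "x \<in> S" "y \<in> S"
  shows "B #>\<^bsub>add_monoid (ring_on S)\<^esub> x = B #>\<^bsub>add_monoid (ring_on S)\<^esub> y \<longleftrightarrow> x - y \<in> B"
proof -
  interpret B: subring_set B by fact
  have eq: "B #>\<^bsub>add_monoid (ring_on S)\<^esub> z = {b + z | b. b \<in> B}" for z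
    by (auto simp: r_coset_def)
  show ?thesis
  proof
    assume "B #>\<^bsub>add_monoid (ring_on S)\<^esub> x = B #>\<^bsub>add_monoid (ring_on S)\<^esub> y"
    moreover have "x \<in> B #>\<^bsub>add_monoid (ring_on S)\<^esub> x"
      unfolding eq using B.zero_mem by (intro CollectI exI[of _ 0]) simp
    ultimately obtain b where "x = b + y" "b \<in> B" unfolding eq by blast
    then show "x - y \<in> B" by simp
  next
    assume d: "x - y \<in> B"
    have "b + x \<in> {b + y | b. b \<in> B}" if "b \<in> B" for b
      using B.add_mem[OF that d] by (intro CollectI exI[of _ "b + (x - y)"]) simp
    moreover have "b + y \<in> {b + x | b. b \<in> B}" if "b \<in> B" for b
      using B.diff_mem[OF that d] by (intro CollectI exI[of _ "b - (x - y)"]) simp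
    ultimately show "B #>\<^bsub>add_monoid (ring_on S)\<^esub> x = B #>\<^bsub>add_monoid (ring_on S)\<^esub> y"
      unfolding eq by blast
  qed
qed

text \<open>\<open>\<phi>\<close> is an invariant with finitely many values that separates cosets;
  it may take several values on one coset.\<close>

lemma finite_additive_cosets:
  fixes S B :: "'a::idom set" and \<phi> :: "'a \<Rightarrow> 'b"
  assumes S: "subring_set S" and B: "subring_set B" "B \<subseteq> S" and fin: "finite (\<phi> ` S)"
    and \<phi>: "\<And>x y. x \<in> S \<Longrightarrow> y \<in> S \<Longrightarrow> \<phi> x = \<phi> y \<Longrightarrow> x - y \<in> B"
  shows "finite (additive_cosets S B)"
proof -
  let ?c = "\<lambda>x. B #>\<^bsub>add_monoid (ring_on S)\<^esub> x"
  have "additive_cosets S B = ?c ` S" by (auto simp: additive_cosets_def RCOSETS_def)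
  also have "\<dots> \<subseteq> (?c \<circ> inv_into S \<phi>) ` (\<phi> ` S)"
  proof (intro image_subsetI)
    fix x assume x: "x \<in> S"
    have "?c x = ?c (inv_into S \<phi> (\<phi> x))"
      using x \<phi>[OF x, of "inv_into S \<phi> (\<phi> x)"] inv_into_into[of "\<phi> x" \<phi> S] f_inv_into_f[of "\<phi> x" \<phi> S]
      by (subst additive_cosets_eq_iff[OF S B]) auto
    then show "?c x \<in> (?c \<circ> inv_into S \<phi>) ` (\<phi> ` S)" using x by auto
  qed
  finally show ?thesis using fin finite_subset by blast
qed

lemma prime_dvd_card_additive_cosets:
  fixes S B :: "'a::idom set"
  assumes S: "subring_set S" and B: "subring_set B" "B \<subseteq> S" and fin: "finite (additive_cosets S B)"
    and p: "Factorial_Ring.prime p" and x: "x \<in> S" "x \<notin> B" "of_nat p * x \<in> B"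
  shows "p dvd card (additive_cosets S B)"
proof -
  let ?G = "add_monoid (ring_on S)"
  interpret S: subring_set S by fact
  interpret B: subring_set B by fact
  interpret R: cring "ring_on S" by (rule cring_ring_on[OF S])
  have G: "comm_group ?G" by (rule R.a_comm_group)
  have minv: "inv\<^bsub>?G\<^esub> y = - y" if "y \<in> S" for y
    using R.minus_equality[of "- y" y] that S.uminus_mem by (simp add: a_inv_def)
  have "subgroup B ?G"
  proof (rule group.subgroupI[OF comm_group.axioms(2)[OF G]])
    show "inv\<^bsub>?G\<^esub> y \<in> B" if "y \<in> B" for y
      using minv[of y] that B(2) B.uminus_mem by auto
  qed (use B(2) B.zero_mem B.add_mem in auto)
  then interpret N: normal B ?G by (rule comm_group.subgroup_imp_normal[OF G])
  interpret F: group "?G Mod B" by (rule N.factorgroup_is_group)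
  let ?c = "B #>\<^bsub>?G\<^esub> x"
  have c: "?c \<in> carrier (?G Mod B)" using x(1) by (simp add: carrier_FactGroup)
  have zero: "B #>\<^bsub>?G\<^esub> 0 = B" by (auto simp: r_coset_def)
  have pow: "?c [^]\<^bsub>?G Mod B\<^esub> n = B #>\<^bsub>?G\<^esub> (of_nat n * x)" for n :: nat
  proof (induction n)
    case 0
    show ?case by (simp only: F.nat_pow_0 one_FactGroup of_nat_0 mult_zero_left zero)
  next
    case (Suc n)
    have "of_nat n * x \<in> carrier ?G" "x \<in> carrier ?G"
      using x(1) by (auto intro: S.mult_mem S.of_nat_mem)
    then have "(B #>\<^bsub>?G\<^esub> (of_nat n * x)) <#>\<^bsub>?G\<^esub> ?c = B #>\<^bsub>?G\<^esub> (of_nat n * x \<otimes>\<^bsub>?G\<^esub> x)"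
      by (rule N.rcos_sum)
    moreover have "of_nat n * x \<otimes>\<^bsub>?G\<^esub> x = of_nat (Suc n) * x" by (simp add: algebra_simps)
    ultimately show ?case by (simp only: F.nat_pow_Suc mult_FactGroup Suc)
  qed
  have iff: "B #>\<^bsub>?G\<^esub> y = B \<longleftrightarrow> y \<in> B" if "y \<in> S" for y
    using additive_cosets_eq_iff[OF S B that S.zero_mem] zero by simp
  have "?c [^]\<^bsub>?G Mod B\<^esub> p = \<one>\<^bsub>?G Mod B\<^esub>"
    unfolding pow one_FactGroup using x B(2) iff by blast
  then have "F.ord ?c dvd p" using F.pow_eq_id[OF c] by simp
  moreover have "F.ord ?c \<noteq> 1"
    using F.ord_eq_1[OF c] iff[OF x(1)] x(2) by simp
  ultimately have "F.ord ?c = p" using p by (metis prime_nat_iff)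
  moreover have "F.ord ?c dvd Coset.order (?G Mod B)" by (rule F.ord_dvd_group_order[OF c])
  moreover have "Coset.order (?G Mod B) = card (additive_cosets S B)"
    by (simp add: Coset.order_def FactGroup_def additive_cosets_def)
  ultimately show ?thesis by simp
qed

lemma subring_adjoin_ring:
  fixes A :: "'a::field_char_0 set"
  assumes "subring_set A"
  shows "subring_set (adjoin_ring A x)"
proof -
  interpret subring_set A by fact
  show ?thesis
    unfolding adjoin_ring_eq[OF assms]
  proof
    show "1 \<in> {poly f x | f. f \<in> polys_over A}"
      using polys_one_mem by (intro CollectI exI[of _ 1]) simp
    fix y z assume "y \<in> {poly f x | f. f \<in> polys_over A}" "z \<in> {poly f x | f. f \<in> polys_over A}"
    then obtain f g where "f \<in> polys_over A" "y = poly f x" "g \<in> polys_over A" "z = poly g x" by blast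
    then have "y - z = poly (f - g) x" "f - g \<in> polys_over A" "y * z = poly (f * g) x" "f * g \<in> polys_over A"
      by (auto intro: polys_diff_mem polys_mult_mem)
    then show "y - z \<in> {poly f x | f. f \<in> polys_over A}" "y * z \<in> {poly f x | f. f \<in> polys_over A}"
      by blast+
  qed
qed

section \<open>The order generated by the root: finite index and reduced representatives\<close>

context simple_extension_root
begin

lemma subring_adjoin_field: "subring_set (adjoin_field K \<eta>)"
  using subring_adjoin_ring[OF subring_set_axioms, of \<eta>]
  by (simp add: adjoin_field_eq adjoin_ring_eq[OF subring_set_axioms])

lemma algebraic_int_root:
  assumes "h \<in> polys_over (integers_of K)"
  shows "algebraic_int \<eta>"
proof (rule algebraic_int_root_of_monic[OF monic root])
  show "algebraic_int (coeff h i)" for i using assms by (simp add: polys_over_def integers_of_def)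
qed

lemma algebraic_int_adjoin_ring:
  assumes "h \<in> polys_over (integers_of K)" "x \<in> adjoin_ring (integers_of K) \<eta>"
  shows "algebraic_int x"
proof -
  interpret Z: subring_set "{x :: 'a. algebraic_int x}" by (rule subring_algebraic_int)
  obtain f where "f \<in> polys_over (integers_of K)" "x = poly f \<eta>"
    using assms(2) by (auto simp: adjoin_ring_eq[OF subring_integers_of[OF subring_set_axioms]])
  moreover from this have "f \<in> polys_over {x. algebraic_int x}"
    by (auto simp: polys_over_def integers_of_def)
  ultimately show ?thesis
    using Z.poly_mem[of f \<eta>] algebraic_int_root[OF assms(1)] by simp
qed

lemma adjoin_ring_subset:
  assumes "h \<in> polys_over (integers_of K)"
  shows "adjoin_ring (integers_of K) \<eta> \<subseteq> integers_of (adjoin_field K \<eta>)"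
proof
  fix x assume x: "x \<in> adjoin_ring (integers_of K) \<eta>"
  then obtain f where "f \<in> polys_over (integers_of K)" "x = poly f \<eta>"
    by (auto simp: adjoin_ring_eq[OF subring_integers_of[OF subring_set_axioms]])
  then have "x \<in> adjoin_field K \<eta>"
    using polys_over_mono[of "integers_of K" K] by (auto simp: adjoin_field_eq integers_of_def)
  then show "x \<in> integers_of (adjoin_field K \<eta>)"
    using algebraic_int_adjoin_ring[OF assms x] by (simp add: integers_of_def)
qed

text \<open>For an integral element with reduced polynomial \<open>f\<close>, all coefficients of
  \<open>m * f\<close> are integral. Their residues modulo \<open>m\<close> determine the coset,
  because if two such lists agree, the difference of the reduced polynomials is integral after
  division by \<open>m\<close>.\<close>

lemma finite_index:
  assumes h: "h \<in> polys_over (integers_of K)"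
    and res: "\<And>m. m > 0 \<Longrightarrow> finite_residues (integers_of K) m"
  shows "finite (additive_cosets (integers_of (adjoin_field K \<eta>)) (adjoin_ring (integers_of K) \<eta>))"
proof -
  let ?S = "integers_of (adjoin_field K \<eta>)"
  interpret O: subring_set "integers_of K" by (rule subring_integers_of[OF subring_set_axioms])
  obtain m :: int where m: "m \<noteq> 0"
    "\<And>f. f \<in> polys_over K \<Longrightarrow> degree f < degree h \<Longrightarrow> algebraic_int (poly f \<eta>) \<Longrightarrow>
       smult (of_int m) f \<in> polys_over (integers_of K)"
    using conductor[OF h] by blast
  obtain F where F: "finite F" "\<forall>x\<in>integers_of K. \<exists>f\<in>F. \<exists>r\<in>integers_of K. x = f + of_nat (nat \<bar>m\<bar>) * r"
    using res[of "nat \<bar>m\<bar>"] m(1) unfolding finite_residues_def by auto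
  \<comment> \<open>Residues are taken modulo a natural number while the conductor is an integer;
    its sign is moved into the quotient.\<close>
  have abs_m: "(of_nat (nat \<bar>m\<bar>) :: 'a) = of_int (sgn m) * of_int m"
    by (metis abs_sgn mult.commute of_int_mult of_int_of_nat_eq abs_ge_zero int_nat_eq)
  have "\<forall>x\<in>integers_of K. \<exists>f\<in>F. \<exists>r\<in>integers_of K. x = f + of_int m * r"
  proof
    fix x assume "x \<in> integers_of K"
    then obtain f r where "f \<in> F" "r \<in> integers_of K" "x = f + of_nat (nat \<bar>m\<bar>) * r" using F by blast
    then show "\<exists>f\<in>F. \<exists>r\<in>integers_of K. x = f + of_int m * r"
      unfolding abs_m using O.mult_mem[OF O.of_int_mem]
      by (intro bexI[of _ f] bexI[of _ "of_int (sgn m) * r"]) (auto simp: ac_simps)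
  qed
  then obtain \<rho> \<tau> where rt: "\<And>x. x \<in> integers_of K \<Longrightarrow> \<rho> x \<in> F"
    "\<And>x. x \<in> integers_of K \<Longrightarrow> \<tau> x \<in> integers_of K \<and> x = \<rho> x + of_int m * \<tau> x"
    by metis
  have "\<forall>x\<in>?S. \<exists>f. f \<in> polys_over K \<and> degree f < degree h \<and> x = poly f \<eta>"
    using adjoin_field_reduced by (metis (no_types, lifting) integers_of_def mem_Collect_eq)
  then obtain f where f: "\<And>x. x \<in> ?S \<Longrightarrow> f x \<in> polys_over K \<and> degree (f x) < degree h \<and> x = poly (f x) \<eta>"
    by metis
  have mf: "of_int m * coeff (f x) i \<in> integers_of K" if "x \<in> ?S" for x i
    using m(2)[of "f x"] f[OF that] that by (auto simp: integers_of_def polys_over_def)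
  define \<phi> where "\<phi> x = (\<lambda>i\<in>{..<degree h}. \<rho> (of_int m * coeff (f x) i))" for x
  show ?thesis
  proof (rule finite_additive_cosets[where \<phi> = \<phi>])
    show "subring_set ?S" by (rule subring_integers_of[OF subring_adjoin_field])
    show "subring_set (adjoin_ring (integers_of K) \<eta>)" by (rule subring_adjoin_ring[OF O.subring_set_axioms])
    show "adjoin_ring (integers_of K) \<eta> \<subseteq> ?S" by (rule adjoin_ring_subset[OF h])
    have "\<phi> ` ?S \<subseteq> {..<degree h} \<rightarrow>\<^sub>E F"
      unfolding \<phi>_def using rt(1) mf by (intro image_subsetI) (simp add: restrict_PiE_iff)
    then show "finite (\<phi> ` ?S)" by (rule finite_subset) (auto intro!: finite_PiE F(1))
    fix x y assume xy: "x \<in> ?S" "y \<in> ?S" "\<phi> x = \<phi> y"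
    have "coeff (f x - f y) i \<in> integers_of K" for i
    proof (cases "i < degree h")
      case True
      have "\<phi> x i = \<phi> y i" using xy(3) by simp
      then have eq: "\<rho> (of_int m * coeff (f x) i) = \<rho> (of_int m * coeff (f y) i)"
        using True by (simp add: \<phi>_def)
      note rx = rt(2)[OF mf[OF xy(1), of i]] and ry = rt(2)[OF mf[OF xy(2), of i]]
      have "of_int m * coeff (f x) i - of_int m * coeff (f y) i =
        of_int m * (\<tau> (of_int m * coeff (f x) i) - \<tau> (of_int m * coeff (f y) i))"
        using rx ry eq by (metis add_diff_cancel_left right_diff_distrib)
      then have "of_int m * (coeff (f x) i - coeff (f y) i) =
        of_int m * (\<tau> (of_int m * coeff (f x) i) - \<tau> (of_int m * coeff (f y) i))"
        by (simp only: right_diff_distrib)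
      then have "coeff (f x) i - coeff (f y) i = \<tau> (of_int m * coeff (f x) i) - \<tau> (of_int m * coeff (f y) i)"
        using m(1) by simp
      then show ?thesis using O.diff_mem rx ry by simp
    next
      case False
      then have "coeff (f x) i = 0" "coeff (f y) i = 0"
        using f[OF xy(1)] f[OF xy(2)] by (auto intro!: coeff_eq_0)
      then show ?thesis using O.zero_mem by simp
    qed
    then have "f x - f y \<in> polys_over (integers_of K)" by (simp add: polys_over_def)
    moreover have "x - y = poly (f x - f y) \<eta>" using f[OF xy(1)] f[OF xy(2)] by simp
    ultimately show "x - y \<in> adjoin_ring (integers_of K) \<eta>"
      unfolding adjoin_ring_eq[OF O.subring_set_axioms] by blast
  qed
qed

text \<open>Reducing an integral representative by the monic integral \<open>h\<close> keeps it
  integral, and the reduced representative over \<open>K\<close> is unique.\<close>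

lemma reduced_poly_of_adjoin_ring:
  assumes h: "h \<in> polys_over (integers_of K)" and f: "f \<in> polys_over K" "degree f < degree h"
    and mem: "poly f \<eta> \<in> adjoin_ring (integers_of K) \<eta>"
  shows "f \<in> polys_over (integers_of K)"
proof -
  interpret O: subring_set "integers_of K" by (rule subring_integers_of[OF subring_set_axioms])
  obtain g where g: "g \<in> polys_over (integers_of K)" "poly f \<eta> = poly g \<eta>"
    using mem by (auto simp: adjoin_ring_eq[OF O.subring_set_axioms])
  obtain q r where qr: "r \<in> polys_over (integers_of K)" "g = h * q + r" "r = 0 \<or> degree r < degree h"
    using O.monic_division[OF h monic g(1)] by blast
  have "r \<in> polys_over K"
    using qr(1) by (auto simp: polys_over_def integers_of_def)
  moreover have "poly (f - r) \<eta> = 0" using g qr(2) root by simp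
  moreover have "degree (f - r) < degree h"
    using f(2) qr(3) degree_diff_less[of f "degree h" r] degree_pos by auto
  ultimately have "f - r = 0" using f(1) by (intro root_imp_zero polys_diff_mem)
  then show ?thesis using qr(1) by simp
qed

end

text \<open>Finiteness is asserted along with divisibility because \<open>card\<close> of an
  infinite set is 0, which every \<open>p\<close> divides.\<close>

theorem proposition3p1:
  fixes L M :: "'a::field_char_0 set" and h :: "'a poly" and \<eta> :: 'a
    and P :: "'a set" and p :: nat
  assumes "number_field L"
    and "Polynomial.lead_coeff h = 1"
    and "irreducible_over (integers_of L) h"
    and "poly h \<eta> = 0"
    and "Factorial_Ring.prime p"
    and "prime_of L P"
    and "lies_above P p"
    and "prime_divides L P (poly_disc h)"
    and "finite_field_extension L M"
    and "irreducible_over M h"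
    and "ramified_in M P"
  shows "finite (additive_cosets (integers_of (adjoin_field M \<eta>)) (adjoin_ring (integers_of M) \<eta>))
    \<and> p dvd card (additive_cosets (integers_of (adjoin_field M \<eta>)) (adjoin_ring (integers_of M) \<eta>))"
proof -
  have L: "subfield L ring_of_type_algebra" and M: "subfield M ring_of_type_algebra" and LM: "L \<subseteq> M"
    using assms(9) by (auto simp: finite_field_extension_def)
  note L_ring = subfield_subring_set[OF L] and M_ring = subfield_subring_set[OF M]
  have OL_OM: "integers_of L \<subseteq> integers_of M" using LM by (auto simp: integers_of_def)
  interpret OM: subring_set "integers_of M" by (rule subring_integers_of[OF M_ring])
  interpret E: simple_extension_root M h \<eta>
    by (intro simple_extension_root.intro M assms)
  have h_L: "h \<in> polys_over (integers_of L)" using assms(3) by (simp add: irreducible_over_def)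
  then have h_M: "h \<in> polys_over (integers_of M)" using polys_over_mono[OF OL_OM] by blast
  note P = prime_of_props[OF L_ring assms(6)]
  have pP: "of_nat p \<in> P" by (rule lies_above_imp_mem[OF assms(7)])
  have p0: "p > 0" using assms(5) by (rule prime_gt_0_nat)
  interpret P: integral_residue_prime L P p
    by (intro integral_residue_prime.intro residue_prime.intro residue_ideal.intro residue_ideal_axioms.intro
        residue_prime_axioms.intro integral_residue_prime_axioms.intro P(2-4) assms(5) pP L
        finite_residues_integers_of[OF assms(1) finite_field_extension_self[OF assms(1)] p0])
  have "poly_disc h \<in> P" by (rule prime_divides_imp_mem[OF L_ring assms(6,8)])
  \<comment> \<open>Multiplying by the sign a second time cancels it, and the leading coefficient in
    the denominator is 1, so what remains is the resultant.\<close>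
  then have "(- 1) ^ (degree h * (degree h - 1) div 2) * poly_disc h \<in> P"
    by (intro P.I_absorb P.power_mem P.uminus_mem P.one_mem)
  then have "resultant h (pderiv h) \<in> P"
    using assms(2) by (simp add: poly_disc_def flip: mult.assoc power_mult_distrib)
  \<comment> \<open>Separability is read off from irreducibility over \<open>M\<close>, while the
    factorisation takes place over the integers of \<open>L\<close>.\<close>
  then obtain g k where gk: "g \<in> polys_over (integers_of L)" "k \<in> polys_over (integers_of L)"
    "lead_coeff g = 1" "lead_coeff k = 1" "degree g > 0" and r: "h - g ^ 2 * k \<in> polys_over P"
    using P.square_factor_mod_if_resultant_mem[OF h_L assms(2) E.separable] by blast
  have gk_M: "g \<in> polys_over (integers_of M)" "k \<in> polys_over (integers_of M)"
    using gk polys_over_mono[OF OL_OM] by auto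
  have nz: "g \<noteq> 0" "k \<noteq> 0" using gk by auto
  \<comment> \<open>A larger degree would make -1 a coefficient of the difference and so an element
    of \<open>P\<close>. As \<open>degree g > 0\<close>, dropping one factor \<open>g\<close> then
    gives a strict bound for \<open>g * k\<close>.\<close>
  have "degree (g ^ 2 * k) \<le> degree h"
  proof (rule ccontr)
    assume "\<not> degree (g ^ 2 * k) \<le> degree h"
    then have "coeff (h - g ^ 2 * k) (degree (g ^ 2 * k)) = - lead_coeff (g ^ 2 * k)"
      by (simp add: coeff_eq_0)
    also have "\<dots> = - 1" using gk by (simp add: lead_coeff_mult lead_coeff_power)
    finally have "- 1 \<in> P" using r unfolding polys_over_def by (metis mem_Collect_eq)
    then show False using P.I_uminus[of "- 1"] P(3) by simp
  qed
  then have deg: "degree (g * k) < degree h"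
    using nz gk(5) by (simp add: degree_mult_eq power2_eq_square)
  obtain Q where Q: "prime_of M Q" and PQ: "P \<subseteq> ideal_prod (ring_on (integers_of M)) Q Q"
    using ramified_imp_square[OF M_ring _ assms(11)] P.I_subset OL_OM by blast
  note Qp = prime_of_props[OF M_ring Q]
  have pQ: "of_nat p \<in> Q"
    using pP PQ ideal_prod_subset(1)[OF OM.subring_set_axioms Qp(1) Qp(1)] by blast
  interpret Q: residue_ideal "integers_of M" Q p
    by (intro residue_ideal.intro residue_ideal_axioms.intro Qp(2,3) assms(5) pQ
        finite_residues_integers_of[OF assms(1,9) p0])
  obtain b where b: "b \<in> integers_of M" "b / of_nat p \<notin> integers_of M"
    "\<And>q. q \<in> Q \<Longrightarrow> b / of_nat p * q \<in> integers_of M"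
    using Q.inverse_ideal_element by blast
  define t where "t = b / of_nat p"
  have t_M: "t \<in> M"
    unfolding t_def divide_inverse using b(1)
    by (intro E.mult_mem subfield_inverse_mem[OF M] E.of_nat_mem) (simp add: integers_of_def)
  define x where "x = poly (smult t (g * k)) \<eta>"
  let ?S = "integers_of (adjoin_field M \<eta>)" and ?B = "adjoin_ring (integers_of M) \<eta>"
  have gkM: "g * k \<in> polys_over (integers_of M)" by (rule OM.polys_mult_mem[OF gk_M])
  have f_M: "smult t (g * k) \<in> polys_over M"
    using gkM t_M polys_over_mono[of "integers_of M" M] by (intro E.smult_mem) (auto simp: integers_of_def)
  note B_eq = adjoin_ring_eq[OF OM.subring_set_axioms, of \<eta>]
  \<comment> \<open>Modulo \<open>h(\<eta>) = 0\<close>, the square of \<open>g(\<eta>) k(\<eta>)\<close> lies in \<open>P k(\<eta>)\<close>, and \<open>t\<^sup>2 P\<close> is integral.\<close>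
  have "x\<^sup>2 \<in> ?B"
  proof -
    let ?r = "h - g ^ 2 * k"
    have "coeff (smult (t * t) ?r) i \<in> integers_of M" for i
    proof -
      have "coeff ?r i \<in> P" using r by (simp add: polys_over_def)
      then have "t * t * coeff ?r i \<in> integers_of M"
        using square_clears_ideal_prod[OF OM.subring_set_axioms b(3)[folded t_def]] PQ by blast
      then show ?thesis by simp
    qed
    then have "smult (t * t) ?r \<in> polys_over (integers_of M)" unfolding polys_over_def by blast
    then have "- (smult (t * t) ?r * k) \<in> polys_over (integers_of M)"
      using OM.polys_diff_mem[OF OM.polys_zero_mem OM.polys_mult_mem[OF _ gk_M(2)]] by fastforce
    moreover have "x\<^sup>2 = poly (- (smult (t * t) ?r * k)) \<eta>"
      using assms(4) by (simp add: x_def power2_eq_square algebra_simps)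
    ultimately show ?thesis unfolding B_eq by blast
  qed
  then have "algebraic_int (x\<^sup>2)" by (rule E.algebraic_int_adjoin_ring[OF h_M])
  then have "algebraic_int x"
    by (rule algebraic_int_root[where p = "monom 1 2"]) (auto simp: poly_monom degree_monom_eq)
  moreover have "x \<in> adjoin_field M \<eta>" unfolding x_def E.adjoin_field_eq using f_M by blast
  ultimately have x_S: "x \<in> ?S" by (simp add: integers_of_def)
  have x_B: "x \<notin> ?B"
  proof
    assume "x \<in> ?B"
    moreover have "degree (smult t (g * k)) < degree h" using deg degree_smult_le[of t "g * k"] by simp
    ultimately have "smult t (g * k) \<in> polys_over (integers_of M)"
      using E.reduced_poly_of_adjoin_ring[OF h_M f_M] by (simp add: x_def)
    then have "coeff (smult t (g * k)) (degree (g * k)) \<in> integers_of M" by (simp add: polys_over_def)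
    then show False using b(2) gk by (simp add: lead_coeff_mult t_def)
  qed
  have px_B: "of_nat p * x \<in> ?B"
  proof -
    have "smult (t * of_nat p) (g * k) \<in> polys_over (integers_of M)"
      using b(3)[OF pQ] gkM by (intro OM.smult_mem) (simp_all add: t_def)
    moreover have "of_nat p * x = poly (smult (t * of_nat p) (g * k)) \<eta>" by (simp add: x_def)
    ultimately show ?thesis unfolding B_eq by blast
  qed
  have fin: "finite (additive_cosets ?S ?B)"
    using E.finite_index[OF h_M] finite_residues_integers_of[OF assms(1,9)] by blast
  moreover have "p dvd card (additive_cosets ?S ?B)"
    by (rule prime_dvd_card_additive_cosets[OF subring_integers_of[OF E.subring_adjoin_field]
          subring_adjoin_ring[OF OM.subring_set_axioms] E.adjoin_ring_subset[OF h_M] fin assms(5) x_S x_B px_B])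
  ultimately show ?thesis by blast
qed

end
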